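(* Let $n\ge 2$ be an integer, let $U\subset\mathbb{R}^{n-1}$ be a connected bounded open set, let $g:U\to\mathbb{R}$ be a $C^2$ function, and let $\mathcal{M}=\{(\mathbf{x},g(\mathbf{x})):\mathbf{x}\in U\}\subset\mathbb{R}^n$ be its graph. Let $\theta:\mathcal{M}\to\mathbb{R}$ be a $C^2$ function, let $\Psi:\mathbb{Z}^n\to[0,\infty)$ be a multivariable approximating function, and let $f$ be a dimension function. Assume: (I) there exist a real number $s<2(n-2)$ and a constant $c>0$ such that $f(xy)\le c\,x^s f(y)$ for all real $x,y$ with $0<y<1<x$; (II) $\mathcal{H}^f\big(\{\mathbf{x}\in U:\nabla^2 g(\mathbf{x})\text{ is singular}\}\big)=0$, where $\nabla^2 g$ denotes the Hessian matrix of $g$. If the series $$\sum_{\mathbf{q}\in\mathbb{Z}^n\setminus\{\mathbf{0}\}}\|\mathbf{q}\|^{n-1}\,\Psi(\mathbf{q})^{2-n}\,f\!\left(\frac{\Psi(\mathbf{q})}{\|\mathbf{q}\|}\right)$$ converges, then $$\mathcal{H}^f\big(W_n^{\theta}(\Psi)\cap\mathcal{M}\big)=0.$$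
   Context: For $\mathbf{q}=(q_1,\dots,q_n)\in\mathbb{Z}^n$, $\|\mathbf{q}\|=\max(|q_1|,\dots,|q_n|)$. A multivariable approximating function is a function $\Psi:\mathbb{Z}^n\to[0,\infty)$ with $\Psi(\mathbf{q})\to 0$ as $\|\mathbf{q}\|\to\infty$ (no monotonicity is assumed). Terms of the series with $\Psi(\mathbf{q})=0$ are interpreted as $0$. The set $W_n^\theta(\Psi)\cap\mathcal{M}$ is the set of all $\mathbf{y}=(y_1,\dots,y_n)\in\mathcal{M}$ such that $$|q_1y_1+\cdots+q_ny_n-p-\theta(\mathbf{y})|<\Psi(\mathbf{q})$$ for infinitely many $(p,\mathbf{q})=(p,q_1,\dots,q_n)\in\mathbb{Z}^{n+1}$. That $\theta:\mathcal{M}\to\mathbb{R}$ is $C^2$ means that $\mathbf{x}\mapsto\theta(\mathbf{x},g(\mathbf{x}))$ is $C^2$ on $U$. A dimension function is an increasing continuous function $f:\mathbb{R}\to\mathbb{R}$ with $f(0)=0$ (only its values on $[0,\infty)$ matter). The $f$-dimensional Hausdorff measure of $\Omega\subset\mathbb{R}^m$ is $\mathcal{H}^f(\Omega)=\lim_{\rho\to0}\inf\sum_i f(\operatorname{diam}B_i)$, where the infimum is over all finite or countable collections $\{B_i\}$ of subsets of $\mathbb{R}^m$ that cover $\Omega$ and satisfy $\operatorname{diam}B_i\le\rho$. *)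

theory Defs
  imports "HOL-Analysis.Analysis"
begin

section \<open>Twice continuously differentiable functions\<close>

definition gradient :: "(real^'m \<Rightarrow> real) \<Rightarrow> real^'m \<Rightarrow> real^'m"
  where "gradient g x = (\<chi> i. frechet_derivative g (at x) (axis i 1))"

definition hessian :: "(real^'m \<Rightarrow> real) \<Rightarrow> real^'m \<Rightarrow> real^'m^'m"
  where "hessian g x = jacobian (gradient g) (at x)"

text \<open>Meant for open sets \<open>U\<close>, on which differentiability within \<open>U\<close> is differentiability at
  every point of \<open>U\<close>.\<close>

definition C2_on :: "(real^'m) set \<Rightarrow> (real^'m \<Rightarrow> real) \<Rightarrow> bool"
  where "C2_on U g \<longleftrightarrow>
    g differentiable_on U \<and> gradient g differentiable_on U \<and> continuous_on U (hessian g)"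


section \<open>Hausdorff measures\<close>

text \<open>Only the values on the closed half-line matter, so nothing is required of negative
  arguments; every such function extends to an increasing continuous function on the whole line.\<close>

definition dimension_function :: "(real \<Rightarrow> real) \<Rightarrow> bool"
  where "dimension_function f \<longleftrightarrow> mono_on {0..} f \<and> continuous_on {0..} f \<and> f 0 = 0"

text \<open>Finite covers are included because a sequence may be padded with empty sets, which
  contribute \<open>f 0 = 0\<close>. Boundedness is required explicitly since the library
  assigns diameter \<open>0\<close> to unbounded sets.\<close>

definition hausdorff_premeasure ::
    "(real \<Rightarrow> real) \<Rightarrow> real \<Rightarrow> 'a::metric_space set \<Rightarrow> ennreal"
  where "hausdorff_premeasure f \<rho> \<Omega> =
    (INF B \<in> {B :: nat \<Rightarrow> 'a set.
                \<Omega> \<subseteq> (\<Union>i. B i) \<and> (\<forall>i. bounded (B i) \<and> diameter (B i) \<le> \<rho>)}.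
       \<Sum>i. ennreal (f (diameter (B i))))"

definition hausdorff_measure :: "(real \<Rightarrow> real) \<Rightarrow> 'a::metric_space set \<Rightarrow> ennreal"
  where "hausdorff_measure f \<Omega> = Lim (at_right 0) (\<lambda>\<rho>. hausdorff_premeasure f \<rho> \<Omega>)"

lemma hausdorff_premeasure_antimono:
  assumes "\<rho> \<le> \<rho>'"
  shows "hausdorff_premeasure f \<rho>' \<Omega> \<le> hausdorff_premeasure f \<rho> \<Omega>"
  unfolding hausdorff_premeasure_def
  by (rule INF_superset_mono) (use assms in \<open>auto intro: order_trans\<close>)

lemma tendsto_hausdorff_premeasure_SUP:
  "((\<lambda>\<rho>. hausdorff_premeasure f \<rho> \<Omega>) \<longlongrightarrow> (SUP \<rho>\<in>{0<..}. hausdorff_premeasure f \<rho> \<Omega>))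
     (at_right 0)"
proof (rule increasing_tendsto)
  show "\<forall>\<^sub>F \<rho> in at_right 0.
      hausdorff_premeasure f \<rho> \<Omega> \<le> (SUP \<rho>\<in>{0<..}. hausdorff_premeasure f \<rho> \<Omega>)"
    unfolding eventually_at_right_field by (intro exI[of _ 1]) (auto intro: SUP_upper)
next
  fix a assume "a < (SUP \<rho>\<in>{0<..}. hausdorff_premeasure f \<rho> \<Omega>)"
  then obtain \<rho>' where "\<rho>' > 0" "a < hausdorff_premeasure f \<rho>' \<Omega>"
    by (auto simp: less_SUP_iff)
  then show "\<forall>\<^sub>F \<rho> in at_right 0. a < hausdorff_premeasure f \<rho> \<Omega>"
    unfolding eventually_at_right_field
    by (intro exI[of _ \<rho>'])
       (auto intro: less_le_trans[OF _ hausdorff_premeasure_antimono])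
qed

lemma hausdorff_measure_eq_SUP:
  "hausdorff_measure f \<Omega> = (SUP \<rho>\<in>{0<..}. hausdorff_premeasure f \<rho> \<Omega>)"
  unfolding hausdorff_measure_def
  by (rule tendsto_Lim[OF _ tendsto_hausdorff_premeasure_SUP]) simp


section \<open>Inhomogeneous dual approximation on a graph\<close>

text \<open>With \<open>n = CARD('m) + 1\<close>, the space \<open>(real^'m) \<times> real\<close>, whose product metric is the
  Euclidean one, plays the role of \<open>n\<close>-dimensional space, and \<open>(int^'m) \<times> int\<close> that of its
  integer lattice.\<close>

definition sup_norm :: "(int^'m) \<times> int \<Rightarrow> real"
  where "sup_norm q = real_of_int (Max (insert \<bar>snd q\<bar> (range (\<lambda>i. \<bar>fst q $ i\<bar>))))"

definition int_dot :: "(int^'m) \<times> int \<Rightarrow> (real^'m) \<times> real \<Rightarrow> real"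
  where "int_dot q y =
    (\<Sum>i\<in>UNIV. real_of_int (fst q $ i) * fst y $ i) + real_of_int (snd q) * snd y"

definition graph_over :: "(real^'m) set \<Rightarrow> (real^'m \<Rightarrow> real) \<Rightarrow> ((real^'m) \<times> real) set"
  where "graph_over U g = (\<lambda>x. (x, g x)) ` U"

definition approximating_function :: "((int^'m) \<times> int \<Rightarrow> real) \<Rightarrow> bool"
  where "approximating_function \<Psi> \<longleftrightarrow>
    (\<forall>q. \<Psi> q \<ge> 0) \<and> (\<Psi> \<longlongrightarrow> 0) (filtercomap sup_norm at_top)"

definition W_on ::
    "((real^'m) \<times> real) set \<Rightarrow> ((real^'m) \<times> real \<Rightarrow> real) \<Rightarrow> ((int^'m) \<times> int \<Rightarrow> real) \<Rightarrow>
      ((real^'m) \<times> real) set"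
  where "W_on M \<theta> \<Psi> =
    {y \<in> M. infinite {(p::int, q). \<bar>int_dot q y - real_of_int p - \<theta> y\<bar> < \<Psi> q}}"

end

theory Submission
  imports Defs
begin

text \<open>
  Let \<open>x\<^sub>0\<close> be a point where the Hessian of \<open>g\<close> is nonsingular. On a small ball \<open>B\<close> around it
  \<open>\<nabla>g\<close> is bi-Lipschitz, so for all large \<open>q = (q', q\<^sub>n)\<close>, with \<open>Q = \<parallel>q\<parallel>\<close>, the function
  \<open>F x = (q' \<bullet> x + q\<^sub>n g(x) - p - \<theta>(x)) / Q\<close> satisfies
  \<open>\<bar>\<nabla>F(x)\<bar> + \<bar>\<nabla>F(y)\<bar> \<ge> \<kappa> \<bar>x - y\<bar>\<close> on \<open>B\<close>: either \<open>q\<^sub>n\<close> is comparable to \<open>Q\<close> and \<open>\<nabla>F\<close> inherits the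
  lower Lipschitz bound of \<open>\<nabla>g\<close>, or \<open>q'\<close> dominates and \<open>\<nabla>F\<close> is bounded away from \<open>0\<close>.
  Consequently \<open>{\<bar>\<nabla>F\<bar> \<le> 2t}\<close> has diameter \<open>O(t)\<close>, and the part of \<open>{\<bar>F\<bar> < \<eta>}\<close>
  where \<open>t \<le> \<bar>\<nabla>F\<bar> \<le> 2t\<close> is covered by \<open>O((t\<^sup>2/\<eta>)\<^sup>n\<^sup>-\<^sup>2)\<close> sets of diameter \<open>O(\<eta>/t)\<close>.
  Summing over the dyadic values \<open>t \<ge> \<surd>\<eta>\<close> and using \<open>s < 2(n - 2)\<close> bounds the total cost by
  \<open>O(\<eta>\<^sup>2\<^sup>-\<^sup>n f(\<eta>))\<close>; the remaining part, where \<open>\<bar>\<nabla>F\<bar> = O(\<surd>\<eta>)\<close>, is a single piece of no larger cost.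
  With \<open>\<eta> = \<Psi>(q)/Q\<close> and \<open>O(Q)\<close> relevant values of \<open>p\<close> this is the term of the given series, and a
  Borel--Cantelli argument applies.
\<close>

section \<open>Null sets of Hausdorff measures\<close>

lemma hausdorff_premeasure_le:
  assumes "\<Omega> \<subseteq> (\<Union>i. B i)" "\<And>i. bounded (B i)" "\<And>i. diameter (B i) \<le> \<rho>"
  shows "hausdorff_premeasure f \<rho> \<Omega> \<le> (\<Sum>i. ennreal (f (diameter (B i))))"
  unfolding hausdorff_premeasure_def by (rule INF_lower) (use assms in auto)

lemma hausdorff_premeasure_mono:
  assumes "A \<subseteq> B"
  shows "hausdorff_premeasure f \<rho> A \<le> hausdorff_premeasure f \<rho> B"
  unfolding hausdorff_premeasure_def
  by (rule INF_superset_mono) (use assms in auto)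

lemma hausdorff_premeasure_single:
  assumes "f 0 = 0" "bounded A" "diameter A \<le> \<rho>"
  shows "hausdorff_premeasure f \<rho> A \<le> ennreal (f (diameter A))"
proof -
  let ?B = "\<lambda>i::nat. if i = 0 then A else {}"
  have "\<rho> \<ge> 0" using assms(3) diameter_ge_0[OF assms(2)] by linarith
  then have "hausdorff_premeasure f \<rho> A \<le> (\<Sum>i. ennreal (f (diameter (?B i))))"
    using assms by (intro hausdorff_premeasure_le) (auto split: if_splits)
  also have "\<dots> = (\<Sum>i\<in>{0}. ennreal (f (diameter (?B i))))"
    by (rule suminf_finite) (use assms in auto)
  finally show ?thesis by simp
qed

lemma hausdorff_premeasure_empty:
  assumes "f 0 = 0" "\<rho> \<ge> 0"
  shows "hausdorff_premeasure f \<rho> {} = 0"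
  using hausdorff_premeasure_single[of f "{}" \<rho>] assms by simp

text \<open>Each piece has a cover whose cost exceeds the infimum by at most
  \<open>e * (1/2) ^ Suc i\<close>. Flattening the double sequence of covers along
  \<open>prod_decode\<close> covers the union, and the excesses add up to \<open>e\<close>.\<close>

lemma hausdorff_premeasure_UN_nat:
  fixes \<Omega> :: "nat \<Rightarrow> 'a::metric_space set"
  shows "hausdorff_premeasure f \<rho> (\<Union>i. \<Omega> i) \<le> (\<Sum>i. hausdorff_premeasure f \<rho> (\<Omega> i))"
proof (rule ennreal_le_epsilon)
  fix e :: real
  assume fin: "(\<Sum>i. hausdorff_premeasure f \<rho> (\<Omega> i)) < top" and e: "0 < e"
  have "\<exists>B. \<Omega> i \<subseteq> (\<Union>j. B j) \<and> (\<forall>j. bounded (B j) \<and> diameter (B j) \<le> \<rho>) \<and>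
      (\<Sum>j. ennreal (f (diameter (B j)))) \<le> hausdorff_premeasure f \<rho> (\<Omega> i) + ennreal (e * (1/2) ^ Suc i)" for i
  proof -
    \<comment> \<open>Adding a positive number increases the value strictly only if it is finite;
      finiteness of each term is inherited from the total.\<close>
    have "hausdorff_premeasure f \<rho> (\<Omega> i) < top"
      using ennreal_suminf_lessD[OF fin] .
    then have "hausdorff_premeasure f \<rho> (\<Omega> i) < hausdorff_premeasure f \<rho> (\<Omega> i) + ennreal (e * (1/2) ^ Suc i)"
      using e by (cases "hausdorff_premeasure f \<rho> (\<Omega> i)") (auto simp: ennreal_plus[symmetric] ennreal_less_iff simp del: ennreal_plus)
    then obtain B where "B \<in> {B :: nat \<Rightarrow> 'a set.
                \<Omega> i \<subseteq> (\<Union>i. B i) \<and> (\<forall>i. bounded (B i) \<and> diameter (B i) \<le> \<rho>)}" 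
       "(\<Sum>j. ennreal (f (diameter (B j)))) < hausdorff_premeasure f \<rho> (\<Omega> i) + ennreal (e * (1/2) ^ Suc i)"
      unfolding hausdorff_premeasure_def[of f \<rho> "\<Omega> i"] INF_less_iff by blast
    then show ?thesis by (intro exI[of _ B]) auto
  qed
  then obtain B where B: "\<And>i. \<Omega> i \<subseteq> (\<Union>j. B i j)" "\<And>i j. bounded (B i j)" "\<And>i j. diameter (B i j) \<le> \<rho>"
      "\<And>i. (\<Sum>j. ennreal (f (diameter (B i j)))) \<le> hausdorff_premeasure f \<rho> (\<Omega> i) + ennreal (e * (1/2) ^ Suc i)"
    by metis
  define C where "C k = (case prod_decode k of (i, j) \<Rightarrow> B i j)" for k
  have "(\<Union>i. \<Omega> i) \<subseteq> (\<Union>k. C k)"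
  proof
    fix x assume "x \<in> (\<Union>i. \<Omega> i)"
    then obtain i j where "x \<in> B i j" using B(1) by blast
    then have "x \<in> C (prod_encode (i, j))" by (simp add: C_def)
    then show "x \<in> (\<Union>k. C k)" by blast
  qed
  then have "hausdorff_premeasure f \<rho> (\<Union>i. \<Omega> i) \<le> (\<Sum>k. ennreal (f (diameter (C k))))"
    by (rule hausdorff_premeasure_le) (auto simp: C_def B split: prod.split)
  also have "\<dots> = (\<Sum>i. \<Sum>j. ennreal (f (diameter (B i j))))"
    using suminf_ennreal_2dimen[of "\<lambda>i. \<Sum>j. ennreal (f (diameter (B i j)))"
        "\<lambda>(i, j). ennreal (f (diameter (B i j)))"]
    by (simp add: C_def comp_def case_prod_unfold)
  also have "\<dots> \<le> (\<Sum>i. hausdorff_premeasure f \<rho> (\<Omega> i) + ennreal (e * (1/2) ^ Suc i))"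
    by (intro suminf_le B(4)) auto
  also have "\<dots> = (\<Sum>i. hausdorff_premeasure f \<rho> (\<Omega> i)) + (\<Sum>i. ennreal (e * (1/2) ^ Suc i))"
    by (rule suminf_add[symmetric]) auto
  also have "(\<Sum>i. ennreal (e * (1/2) ^ Suc i)) = ennreal e"
    using sums_mult[OF power_half_series, of e] e by (intro suminf_ennreal_eq) auto
  finally show "hausdorff_premeasure f \<rho> (\<Union>i. \<Omega> i) \<le> (\<Sum>i. hausdorff_premeasure f \<rho> (\<Omega> i)) + ennreal e" .
qed

lemma hausdorff_premeasure_Un:
  assumes "f 0 = 0" "\<rho> \<ge> 0"
  shows "hausdorff_premeasure f \<rho> (A \<union> B) \<le> hausdorff_premeasure f \<rho> A + hausdorff_premeasure f \<rho> B"
proof -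
  let ?C = "\<lambda>i::nat. if i = 0 then A else if i = 1 then B else {}"
  have "A \<union> B = (\<Union>i. ?C i)" by (auto split: if_splits)
  then have "hausdorff_premeasure f \<rho> (A \<union> B) \<le> (\<Sum>i. hausdorff_premeasure f \<rho> (?C i))"
    using hausdorff_premeasure_UN_nat[of f \<rho> ?C] by (simp only:)
  also have "\<dots> = (\<Sum>i\<in>{0,1}. hausdorff_premeasure f \<rho> (?C i))"
    by (rule suminf_finite) (auto simp: hausdorff_premeasure_empty[of f, OF assms])
  finally show ?thesis by simp
qed

lemma hausdorff_premeasure_UN_finite:
  assumes "f 0 = 0" "\<rho> \<ge> 0" "finite I"
  shows "hausdorff_premeasure f \<rho> (\<Union>i\<in>I. \<Omega> i) \<le> (\<Sum>i\<in>I. hausdorff_premeasure f \<rho> (\<Omega> i))"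
  using \<open>finite I\<close>
proof induction
  case empty
  then show ?case by (simp add: hausdorff_premeasure_empty assms)
next
  case (insert a I)
  have "hausdorff_premeasure f \<rho> (\<Union>i\<in>insert a I. \<Omega> i)
      \<le> hausdorff_premeasure f \<rho> (\<Omega> a) + hausdorff_premeasure f \<rho> (\<Union>i\<in>I. \<Omega> i)"
    using hausdorff_premeasure_Un[of f \<rho> "\<Omega> a" "\<Union>i\<in>I. \<Omega> i"] assms by simp
  also have "\<dots> \<le> hausdorff_premeasure f \<rho> (\<Omega> a) + (\<Sum>i\<in>I. hausdorff_premeasure f \<rho> (\<Omega> i))"
    by (intro add_left_mono insert)
  finally show ?case using insert by simp
qed

section \<open>Null sets: countable unions, Lipschitz images, limsup sets\<close>

lemma hausdorff_null_iff:
  "hausdorff_measure f \<Omega> = 0 \<longleftrightarrow> (\<forall>\<rho>>0. hausdorff_premeasure f \<rho> \<Omega> = 0)"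
  unfolding hausdorff_measure_eq_SUP bot_ennreal[symmetric] SUP_bot_conv by auto

lemma hausdorff_null_subset:
  assumes "A \<subseteq> B" "hausdorff_measure f B = 0"
  shows "hausdorff_measure f A = 0"
  using assms hausdorff_premeasure_mono[OF assms(1)] unfolding hausdorff_null_iff
  by (metis le_zero_eq)

lemma hausdorff_null_UN:
  assumes "f 0 = 0" "countable I" "\<And>i. i \<in> I \<Longrightarrow> hausdorff_measure f (\<Omega> i) = 0"
  shows "hausdorff_measure f (\<Union>i\<in>I. \<Omega> i) = 0"
proof (cases "I = {}")
  case True
  then show ?thesis by (simp add: hausdorff_null_iff hausdorff_premeasure_empty assms)
next
  case False
  have "hausdorff_premeasure f \<rho> (\<Union>i\<in>I. \<Omega> i) = 0" if "\<rho> > 0" for \<rho>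
  proof -
    have "(\<Union>i\<in>I. \<Omega> i) = (\<Union>k. \<Omega> (from_nat_into I k))"
      using range_from_nat_into[OF False assms(2)] image_image[of \<Omega> "from_nat_into I" UNIV]
      by (simp only:)
    then have "hausdorff_premeasure f \<rho> (\<Union>i\<in>I. \<Omega> i)
        \<le> (\<Sum>k. hausdorff_premeasure f \<rho> (\<Omega> (from_nat_into I k)))"
      using hausdorff_premeasure_UN_nat[of f \<rho> "\<lambda>k. \<Omega> (from_nat_into I k)"] by (simp only:)
    also have "\<dots> = 0"
      using assms(3)[OF from_nat_into[OF False]] that by (simp add: hausdorff_null_iff)
    finally show ?thesis by simp
  qed
  then show ?thesis by (simp add: hausdorff_null_iff)
qed

text \<open>If the sets \<open>B i\<close> cover \<open>A\<close>, then the images of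
  \<open>A \<inter> B i\<close> cover the image of \<open>A\<close>, and their diameters grow at
  most by the factor \<open>K\<close>. By \<open>doubling\<close> the total cost grows at most by
  the factor \<open>\<bar>C\<bar>\<close>, so arbitrarily cheap covers stay arbitrarily
  cheap.\<close>

lemma hausdorff_null_lipschitz_image:
  fixes \<phi> :: "'a::metric_space \<Rightarrow> 'b::metric_space"
  assumes f: "dimension_function f"
    and doubling: "\<And>y. 0 < y \<Longrightarrow> y < 1 \<Longrightarrow> f (K * y) \<le> C * f y"
    and lip: "K-lipschitz_on A \<phi>" and "hausdorff_measure f A = 0"
  shows "hausdorff_measure f (\<phi> ` A) = 0"
proof -
  have f0: "f 0 = 0" and fmono: "\<And>x y. 0 \<le> x \<Longrightarrow> x \<le> y \<Longrightarrow> f x \<le> f y"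
    using f by (auto simp: dimension_function_def mono_on_def)
  have K: "K \<ge> 0" using lipschitz_on_nonneg[OF lip] .
  have "hausdorff_premeasure f \<rho> (\<phi> ` A) = 0" if \<rho>: "\<rho> > 0" for \<rho>
  proof -
    \<comment> \<open>Less than 1, so that \<open>doubling\<close> applies to the diameters in a
      cover of \<open>A\<close>, and small enough for the images to have diameter at most
      \<open>\<rho>\<close>. Dividing by \<open>K + 1\<close> also handles
      \<open>K = 0\<close>.\<close>
    define \<rho>' where "\<rho>' = min (1/2) (\<rho> / (K + 1))"
    have \<rho>': "\<rho>' > 0" "\<rho>' < 1" "K * \<rho>' \<le> \<rho>"
    proof -
      have "K * \<rho>' \<le> (K + 1) * (\<rho> / (K + 1))"
        using K \<rho> by (intro mult_mono) (auto simp: \<rho>'_def)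
      then show "K * \<rho>' \<le> \<rho>" using K by simp
    qed (use K \<rho> in \<open>auto simp: \<rho>'_def\<close>)
    have key: "hausdorff_premeasure f \<rho> (\<phi> ` A) \<le> ennreal \<bar>C\<bar> * (\<Sum>i. ennreal (f (diameter (B i))))"
      if B: "A \<subseteq> (\<Union>i. B i)" "\<And>i. bounded (B i)" "\<And>i. diameter (B i) \<le> \<rho>'" for B :: "nat \<Rightarrow> 'a set"
    proof -
      have d: "bounded (\<phi> ` (A \<inter> B i))" "diameter (\<phi> ` (A \<inter> B i)) \<le> K * diameter (B i)" for i
      proof -
        have le: "dist (\<phi> x) (\<phi> y) \<le> K * diameter (B i)" if "x \<in> A \<inter> B i" "y \<in> A \<inter> B i" for x y
        proof -
          have "dist (\<phi> x) (\<phi> y) \<le> K * dist x y" using lipschitz_onD[OF lip] that by blast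
          also have "\<dots> \<le> K * diameter (B i)"
            using diameter_bounded_bound[OF B(2)] that K by (intro mult_left_mono) auto
          finally show ?thesis .
        qed
        then show "bounded (\<phi> ` (A \<inter> B i))" by (auto simp: bounded_two_points)
        show "diameter (\<phi> ` (A \<inter> B i)) \<le> K * diameter (B i)"
        proof (cases "A \<inter> B i = {}")
          case True
          then show ?thesis using K diameter_ge_0[OF B(2), of i] by simp
        next
          case False
          have "dist u v \<le> K * diameter (B i)" if "u \<in> \<phi> ` (A \<inter> B i)" "v \<in> \<phi> ` (A \<inter> B i)" for u v
            using le that by blast
          with False show ?thesis
            unfolding diameter_def[of "\<phi> ` (A \<inter> B i)"] by (auto intro!: cSUP_least)
        qed
      qed
      have "hausdorff_premeasure f \<rho> (\<phi> ` A) \<le> (\<Sum>i. ennreal (f (diameter (\<phi> ` (A \<inter> B i)))))"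
      proof (rule hausdorff_premeasure_le)
        show "diameter (\<phi> ` (A \<inter> B i)) \<le> \<rho>" for i
          using d(2)[of i] mult_left_mono[OF B(3)[of i] K] \<rho>' by linarith
      qed (use B(1) d(1) in \<open>blast+\<close>)
      also have "\<dots> \<le> (\<Sum>i. ennreal \<bar>C\<bar> * ennreal (f (diameter (B i))))"
      proof (intro suminf_le)
        fix i
        have "f (diameter (\<phi> ` (A \<inter> B i))) \<le> \<bar>C\<bar> * f (diameter (B i))"
        proof -
          have "f (diameter (\<phi> ` (A \<inter> B i))) \<le> f (K * diameter (B i))"
            using d[of i] diameter_ge_0 by (intro fmono) auto
          also have "\<dots> \<le> \<bar>C\<bar> * f (diameter (B i))"
          proof (cases "diameter (B i) = 0")
            case True
            then show ?thesis by (simp add: f0)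
          next
            case False
            then have pos: "diameter (B i) > 0" using diameter_ge_0[OF B(2), of i] by simp
            then have "f (K * diameter (B i)) \<le> C * f (diameter (B i))"
              using B(3)[of i] \<rho>' by (intro doubling) auto
            also have "\<dots> \<le> \<bar>C\<bar> * f (diameter (B i))"
              using fmono[of 0 "diameter (B i)"] pos by (intro mult_right_mono) (auto simp: f0)
            finally show ?thesis .
          qed
          finally show ?thesis .
        qed
        then show "ennreal (f (diameter (\<phi> ` (A \<inter> B i)))) \<le> ennreal \<bar>C\<bar> * ennreal (f (diameter (B i)))"
          by (subst ennreal_mult'[symmetric]) (auto intro: ennreal_leI)
      qed auto
      finally show ?thesis by simp
    qed
    have "hausdorff_premeasure f \<rho> (\<phi> ` A) \<le> 0"
    proof (rule ennreal_le_epsilon)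
      fix e :: real assume e: "0 < e"
      have "hausdorff_premeasure f \<rho>' A = 0" using assms(4) \<rho>' by (auto simp: hausdorff_null_iff)
      then have "hausdorff_premeasure f \<rho>' A < ennreal (e / (\<bar>C\<bar> + 1))" using e by (simp add: add_nonneg_pos)
      then obtain B where "B \<in> {B :: nat \<Rightarrow> 'a set.
            A \<subseteq> (\<Union>i. B i) \<and> (\<forall>i. bounded (B i) \<and> diameter (B i) \<le> \<rho>')}"
        and sum: "(\<Sum>i. ennreal (f (diameter (B i)))) < ennreal (e / (\<bar>C\<bar> + 1))"
        unfolding hausdorff_premeasure_def INF_less_iff by blast
      then have "hausdorff_premeasure f \<rho> (\<phi> ` A) \<le> ennreal \<bar>C\<bar> * (\<Sum>i. ennreal (f (diameter (B i))))"
        by (intro key) auto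
      also have "\<dots> \<le> ennreal \<bar>C\<bar> * ennreal (e / (\<bar>C\<bar> + 1))"
        using sum by (intro mult_left_mono) auto
      also have "\<dots> = ennreal (\<bar>C\<bar> * (e / (\<bar>C\<bar> + 1)))" by (rule ennreal_mult'[symmetric]) simp
      also have "\<dots> \<le> ennreal e"
        using e by (intro ennreal_leI) (simp add: field_simps)
      finally show "hausdorff_premeasure f \<rho> (\<phi> ` A) \<le> 0 + ennreal e" by simp
    qed
    then show "hausdorff_premeasure f \<rho> (\<phi> ` A) = 0" by simp
  qed
  then show ?thesis by (simp add: hausdorff_null_iff)
qed

text \<open>By the Lindelof property countably many of the neighbourhoods \<open>V\<close> cover
  \<open>S\<close>, and a countable union of null sets is null.\<close>

lemma hausdorff_null_image_locally:
  fixes S :: "'a::second_countable_topology set"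
  assumes "f 0 = 0" and S: "\<And>x. x \<in> S \<Longrightarrow> \<exists>V. open V \<and> x \<in> V \<and> hausdorff_measure f (\<phi> ` (S \<inter> V)) = 0"
  shows "hausdorff_measure f (\<phi> ` S) = 0"
proof -
  let ?F = "{V. open V \<and> hausdorff_measure f (\<phi> ` (S \<inter> V)) = 0}"
  obtain F where F: "F \<subseteq> ?F" "countable F" "\<Union>F = \<Union>?F"
    using Lindelof[of ?F] by auto
  have "\<phi> ` S \<subseteq> (\<Union>V\<in>F. \<phi> ` (S \<inter> V))"
  proof
    fix y assume "y \<in> \<phi> ` S"
    then obtain x where x: "x \<in> S" "y = \<phi> x" by blast
    then have "x \<in> \<Union>F" using S[of x] unfolding F(3) by blast
    then show "y \<in> (\<Union>V\<in>F. \<phi> ` (S \<inter> V))" using x by blast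
  qed
  moreover have "hausdorff_measure f (\<Union>V\<in>F. \<phi> ` (S \<inter> V)) = 0"
    using F by (intro hausdorff_null_UN) (auto simp: assms(1))
  ultimately show ?thesis by (rule hausdorff_null_subset)
qed

text \<open>The convergence half of Borel--Cantelli, run at each scale \<open>\<rho>\<close>
  separately: every tail of the sequence of sets covers the limsup set, and the tails of a
  convergent series tend to 0. The exceptional set \<open>X\<close> may depend on
  \<open>\<rho>\<close>, so a cost bound valid only for large indices suffices. The fixed set
  \<open>Y\<close> accommodates the index 0 over which the series does not run.\<close>

lemma hausdorff_null_limsup:
  fixes S :: "'q::countable \<Rightarrow> 'a::metric_space set" and u :: "'q \<Rightarrow> real"
  assumes "f 0 = 0" and Y: "finite Y" and nonneg: "\<And>q. q \<notin> Y \<Longrightarrow> 0 \<le> u q" and sum: "u summable_on (- Y)"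
    and K: "K \<ge> 0"
    and bound: "\<And>\<rho>. \<rho> > 0 \<Longrightarrow> \<exists>X. finite X \<and> (\<forall>q. q \<notin> X \<longrightarrow> hausdorff_premeasure f \<rho> (S q) \<le> ennreal (K * u q))"
  shows "hausdorff_measure f {x. infinite {q. x \<in> S q}} = 0"
  unfolding hausdorff_null_iff
proof (intro allI impI)
  fix \<rho> :: real assume \<rho>: "\<rho> > 0"
  obtain X where X: "finite X" "\<And>q. q \<notin> X \<Longrightarrow> hausdorff_premeasure f \<rho> (S q) \<le> ennreal (K * u q)"
    using bound[OF \<rho>] by blast
  define Z where "Z = - (Y \<union> X)"
  define e where "e = from_nat_into Z"
  let ?A = "{x. infinite {q. x \<in> S q}}"
  show "hausdorff_premeasure f \<rho> ?A = 0"
  \<comment> \<open>An infinite \<open>Z\<close> is enumerated by the natural numbers. If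
    \<open>Z\<close> is finite, then so is the index type, and no point lies in infinitely many of
    the sets.\<close>
  proof (cases "infinite Z")
    case False
    then have "finite (UNIV :: 'q set)" unfolding Z_def using Y X(1)
      by (metis Compl_partition finite_UnI)
    then have "?A = {}" by (auto intro: finite_subset)
    then show ?thesis using \<rho> by (simp add: hausdorff_premeasure_empty assms(1))
  next
    case True
    have bij: "bij_betw e UNIV Z" unfolding e_def by (rule bij_betw_from_nat_into) (use True in auto)
    then have eZ: "e k \<in> Z" for k by (auto simp: bij_betw_def)
    have "u summable_on Z" by (rule summable_on_subset_banach[OF sum]) (auto simp: Z_def)
    then have "(\<lambda>k. u (e k)) summable_on UNIV"
      using summable_on_reindex_bij_betw[OF bij, of u] by simp
    then have summ: "summable (\<lambda>k. u (e k))" by (rule summable_on_imp_summable)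
    have ue: "0 \<le> u (e k)" for k using nonneg eZ[of k] by (auto simp: Z_def)
    have "hausdorff_premeasure f \<rho> ?A \<le> 0"
    proof (rule ennreal_le_epsilon)
      fix \<epsilon> :: real assume \<epsilon>: "0 < \<epsilon>"
      obtain N where N: "norm (\<Sum>k. u (e (k + N))) < \<epsilon> / (K + 1)"
        using suminf_exist_split[OF _ summ, of "\<epsilon> / (K + 1)"] \<epsilon> K by (auto simp: divide_pos_pos add_nonneg_pos)
      have "?A \<subseteq> (\<Union>k. S (e (k + N)))"
      proof
        fix x assume "x \<in> ?A"
        then have inf: "infinite {q. x \<in> S q}" by simp
        have "finite (Y \<union> X \<union> e ` {..<N})" using Y X by simp
        then obtain q where q: "x \<in> S q" "q \<notin> Y \<union> X \<union> e ` {..<N}"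
          using inf by (metis (mono_tags, lifting) finite_subset mem_Collect_eq subsetI)
        then have "q \<in> Z" by (simp add: Z_def)
        then obtain k where k: "q = e k" using bij by (auto simp: bij_betw_def)
        with q have "N \<le> k" by (metis UnI2 image_eqI lessThan_iff not_less)
        then have "x \<in> S (e ((k - N) + N))" using q k by simp
        then show "x \<in> (\<Union>k. S (e (k + N)))" by blast
      qed
      then have "hausdorff_premeasure f \<rho> ?A \<le> hausdorff_premeasure f \<rho> (\<Union>k. S (e (k + N)))"
        by (rule hausdorff_premeasure_mono)
      also have "\<dots> \<le> (\<Sum>k. hausdorff_premeasure f \<rho> (S (e (k + N))))"
        by (rule hausdorff_premeasure_UN_nat)
      also have "\<dots> \<le> (\<Sum>k. ennreal (K * u (e (k + N))))"
        using X(2) eZ by (intro suminf_le) (auto simp: Z_def)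
      also have "\<dots> = ennreal (\<Sum>k. K * u (e (k + N)))"
        using K ue summ by (intro suminf_ennreal2 summable_mult summable_ignore_initial_segment) auto
      also have "\<dots> \<le> ennreal \<epsilon>"
      proof (rule ennreal_leI)
        have "(\<Sum>k. K * u (e (k + N))) = K * (\<Sum>k. u (e (k + N)))"
          using summ by (intro suminf_mult summable_ignore_initial_segment)
        also have "\<dots> \<le> K * (\<epsilon> / (K + 1))" using N K by (intro mult_left_mono) auto
        also have "\<dots> \<le> \<epsilon>" using K \<epsilon> by (simp add: field_simps)
        finally show "(\<Sum>k. K * u (e (k + N))) \<le> \<epsilon>" .
      qed
      finally show "hausdorff_premeasure f \<rho> ?A \<le> 0 + ennreal \<epsilon>" by simp
    qed
    then show ?thesis by simp
  qed
qed

section \<open>Covering sublevel sets by the size of the gradient\<close>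

text \<open>The Euclidean norm is at most the l1 norm, hence at most \<open>CARD('m)\<close> times
  the largest coordinate. Applied to a gradient, this selects the steepest coordinate
  direction.\<close>

lemma exists_dominant_coordinate:
  fixes v :: "real^'m"
  obtains i where "norm v \<le> real CARD('m) * \<bar>v $ i\<bar>" "\<And>j. \<bar>v $ j\<bar> \<le> \<bar>v $ i\<bar>"
proof -
  have "Max (range (\<lambda>j. \<bar>v $ j\<bar>)) \<in> range (\<lambda>j. \<bar>v $ j\<bar>)" by (rule Max_in) auto
  then obtain i where "Max (range (\<lambda>j. \<bar>v $ j\<bar>)) = \<bar>v $ i\<bar>" by blast
  then have i: "\<bar>v $ j\<bar> \<le> \<bar>v $ i\<bar>" for j
    using Max_ge[of "range (\<lambda>j. \<bar>v $ j\<bar>)" "\<bar>v $ j\<bar>"] by simp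
  have "norm v \<le> (\<Sum>j\<in>UNIV. \<bar>v $ j\<bar>)" by (rule norm_le_l1_cart)
  also have "\<dots> \<le> real CARD('m) * \<bar>v $ i\<bar>"
    using sum_bounded_above[of UNIV "\<lambda>j. \<bar>v $ j\<bar>" "\<bar>v $ i\<bar>"] i by simp
  finally show thesis using that i by blast
qed

lemma card_floor_interval:
  fixes a b h :: real
  assumes "h > 0" "a \<le> b"
  shows "real (card {\<lfloor>a / h\<rfloor>..\<lfloor>b / h\<rfloor>}) \<le> (b - a) / h + 2"
proof -
  have "a / h \<le> b / h" using assms by (simp add: divide_right_mono)
  then have "\<lfloor>a / h\<rfloor> \<le> \<lfloor>b / h\<rfloor>" by (rule floor_mono)
  then have "real (card {\<lfloor>a / h\<rfloor>..\<lfloor>b / h\<rfloor>}) = real_of_int \<lfloor>b / h\<rfloor> - real_of_int \<lfloor>a / h\<rfloor> + 1"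
    by simp
  also have "\<dots> \<le> b / h - (a / h - 1) + 1" by linarith
  finally show ?thesis by (simp add: diff_divide_distrib)
qed

lemma dist_le_of_floor_eq:
  fixes u v h :: real
  assumes "h > 0" "\<lfloor>u / h\<rfloor> = \<lfloor>v / h\<rfloor>"
  shows "\<bar>u - v\<bar> \<le> h"
proof -
  have "\<bar>u / h - v / h\<bar> \<le> 1" using assms(2) by linarith
  then have "\<bar>(u - v) / h\<bar> \<le> 1" by (simp add: diff_divide_distrib)
  then show ?thesis using assms(1) by (simp add: abs_divide field_simps)
qed

text \<open>Here \<open>u\<close>, \<open>v\<close> are the values of a function at
  \<open>x\<close>, \<open>y\<close>, and \<open>a\<close> is its gradient at \<open>x\<close>. The
  values differ by at most \<open>2 * \<eta>\<close>, so the Taylor bound makes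
  \<open>a \<bullet> (x - y)\<close> small. Its term in the dominant direction \<open>i\<close> has
  size \<open>p * b\<close>; the other terms are small because the other coordinates differ by at
  most \<open>\<epsilon> * r\<close>, and the quadratic error is absorbed by the choice of
  \<open>\<epsilon>\<close>. Dividing by \<open>p\<close> improves the bound on \<open>b\<close>
  from order \<open>t\<close> to order \<open>r\<close>.\<close>

lemma shell_diameter_bound:
  fixes x y a :: "real^'m"
  defines "M \<equiv> real CARD('m)"
  assumes taylor: "\<bar>u - v - a \<bullet> (x - y)\<bar> \<le> L * norm (x - y) ^ 2"
    and "L \<ge> 0" "\<epsilon> > 0" "\<epsilon> * (2 * M * (M + 1) * (L + 1)) \<le> 1"
    and "\<bar>u\<bar> \<le> \<eta>" "\<bar>v\<bar> \<le> \<eta>" "t > 0" "t \<le> norm a" "\<eta> > 0" "r = \<eta> / t" "r \<le> t"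
    and dom: "norm a \<le> M * \<bar>a $ i\<bar>" "\<And>j. \<bar>a $ j\<bar> \<le> \<bar>a $ i\<bar>"
    and near: "\<bar>x $ i - y $ i\<bar> \<le> \<epsilon> * t" "\<And>j. j \<noteq> i \<Longrightarrow> \<bar>x $ j - y $ j\<bar> \<le> \<epsilon> * r"
  shows "norm (x - y) \<le> 8 * M * r"
proof -
  define b where "b = \<bar>x $ i - y $ i\<bar>"
  define p where "p = \<bar>a $ i\<bar>"
  have M: "M \<ge> 1" unfolding M_def by (simp add: Suc_leI)
  have r: "r > 0" using assms by simp
  have sum_le: "(\<Sum>j\<in>UNIV - {i}. c j) \<le> M * z" if "\<And>j. j \<noteq> i \<Longrightarrow> c j \<le> z" "z \<ge> 0" for c :: "'m \<Rightarrow> real" and z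
  proof -
    have "(\<Sum>j\<in>UNIV - {i}. c j) \<le> real (card (UNIV - {i})) * z"
      using that by (intro sum_bounded_above) auto
    also have "\<dots> \<le> M * z" unfolding M_def using that by (intro mult_right_mono) (auto simp: card_mono)
    finally show ?thesis .
  qed
  have d1: "norm (x - y) \<le> b + M * (\<epsilon> * r)"
  proof -
    have "norm (x - y) \<le> (\<Sum>j\<in>UNIV. \<bar>(x - y) $ j\<bar>)" by (rule norm_le_l1_cart)
    also have "\<dots> = b + (\<Sum>j\<in>UNIV - {i}. \<bar>(x - y) $ j\<bar>)"
      by (subst sum.remove[of _ i]) (auto simp: b_def)
    also have "\<dots> \<le> b + M * (\<epsilon> * r)"
      using near(2) r assms(4) by (intro add_left_mono sum_le) auto
    finally show ?thesis .
  qed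
  \<comment> \<open>A rough a priori bound, from \<open>r \<le> t\<close>. It controls one of the
    two factors of the quadratic error.\<close>
  have d2: "norm (x - y) \<le> (M + 1) * (\<epsilon> * t)"
  proof -
    have "M * (\<epsilon> * r) \<le> M * (\<epsilon> * t)" using M assms by (intro mult_left_mono) auto
    then show ?thesis using d1 near(1) by (simp add: b_def algebra_simps)
  qed
  have pt: "t \<le> M * p" using assms(9) dom(1) by (simp add: p_def)
  then have p: "p > 0" using M assms(8) by (metis less_le_trans mult_pos_pos zero_less_mult_pos less_le_trans zero_less_one)
  have "p * b - p * (M * (\<epsilon> * r)) \<le> \<bar>a \<bullet> (x - y)\<bar>"
  proof -
    have "a \<bullet> (x - y) = a $ i * (x $ i - y $ i) + (\<Sum>j\<in>UNIV - {i}. a $ j * (x $ j - y $ j))"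
      by (simp add: inner_vec_def) (subst sum.remove[of _ i], auto)
    moreover have "\<bar>\<Sum>j\<in>UNIV - {i}. a $ j * (x $ j - y $ j)\<bar> \<le> M * (p * (\<epsilon> * r))"
    proof -
      have "\<bar>\<Sum>j\<in>UNIV - {i}. a $ j * (x $ j - y $ j)\<bar> \<le> (\<Sum>j\<in>UNIV - {i}. \<bar>a $ j * (x $ j - y $ j)\<bar>)"
        by (rule sum_abs)
      also have "\<dots> \<le> M * (p * (\<epsilon> * r))"
        unfolding abs_mult p_def using dom near r assms by (intro sum_le mult_mono) auto
      finally show ?thesis .
    qed
    moreover have "\<bar>a $ i * (x $ i - y $ i)\<bar> = p * b" by (simp add: p_def b_def abs_mult)
    ultimately show ?thesis by (simp add: algebra_simps)
  qed
  \<comment> \<open>One factor \<open>norm (x - y)\<close> is estimated by \<open>d2\<close> and the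
    other by \<open>d1\<close>. The smallness condition on \<open>\<epsilon>\<close> yields exactly
    the factor \<open>p / 2\<close>, so half of \<open>p * b\<close> survives.\<close>
  moreover have "L * norm (x - y) ^ 2 \<le> p / 2 * (b + M * (\<epsilon> * r))"
  proof -
    have "L * norm (x - y) ^ 2 = (L * norm (x - y)) * norm (x - y)" by (simp add: power2_eq_square)
    also have "\<dots> \<le> p / 2 * (b + M * (\<epsilon> * r))"
    proof (rule mult_mono)
      have "L * norm (x - y) \<le> (L + 1) * ((M + 1) * (\<epsilon> * (M * p)))"
        using d2 M assms pt
        by (intro mult_mono order_trans[OF d2] mult_left_mono) auto
      also have "\<dots> = p / 2 * (\<epsilon> * (2 * M * (M + 1) * (L + 1)))" by (simp add: algebra_simps)
      also have "\<dots> \<le> p / 2 * 1" using p assms by (intro mult_left_mono) auto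
      finally show "L * norm (x - y) \<le> p / 2" by simp
    qed (use d1 p in auto)
    finally show ?thesis .
  qed
  ultimately have "p * b - p * (M * (\<epsilon> * r)) \<le> 2 * \<eta> + p / 2 * (b + M * (\<epsilon> * r))"
    using taylor assms(6,7) by linarith
  moreover have "2 * \<eta> \<le> p * (2 * M * r)"
  proof -
    have "\<eta> = t * r" using assms by simp
    also have "\<dots> \<le> M * p * r" using pt r by (intro mult_right_mono) auto
    finally show ?thesis by (simp add: algebra_simps)
  qed
  ultimately have "p * b \<le> p * (3 * (M * (\<epsilon> * r)) + 4 * M * r)" by (simp add: algebra_simps)
  then have "b \<le> 3 * (M * (\<epsilon> * r)) + 4 * M * r" using p by simp
  \<comment> \<open>Since \<open>\<epsilon> \<le> 1\<close>, the sum of the bound on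
    \<open>b\<close> and \<open>M * (\<epsilon> * r)\<close> is at most
    \<open>4 * M * r + 4 * M * r\<close>, which is the source of the constant 8.\<close>
  moreover have "M * (\<epsilon> * r) \<le> M * r"
  proof -
    have "\<epsilon> * 1 \<le> \<epsilon> * (2 * M * (M + 1) * (L + 1))"
    proof (intro mult_left_mono)
      have "1 * 1 * 1 \<le> (2 * M) * (M + 1) * (L + 1)" using M assms(3) by (intro mult_mono) auto
      then show "1 \<le> 2 * M * (M + 1) * (L + 1)" by simp
    qed (use assms in auto)
    then have "\<epsilon> \<le> 1" using assms(5) by linarith
    then show ?thesis using M r by (simp add: mult_left_le_one_le assms(4) less_imp_le)
  qed
  ultimately show ?thesis using d1 by linarith
qed

text \<open>The pieces are the cells of a grid that is fine (\<open>\<epsilon>\<eta>/t\<close>) in all directions except that of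
  the largest partial derivative of \<open>F\<close>, where it is coarse (\<open>\<epsilon>t\<close>). Since \<open>F\<close> is steep in that
  direction, \<open>\<bar>F\<bar> \<le> \<eta>\<close> makes the cells short in it as well.\<close>

lemma shell_partition:
  fixes T :: "(real^'m) set" and F :: "real^'m \<Rightarrow> real" and G :: "real^'m \<Rightarrow> real^'m"
  defines "M \<equiv> real CARD('m)"
  assumes taylor: "\<And>x y. x \<in> T \<Longrightarrow> y \<in> T \<Longrightarrow> \<bar>F x - F y - G x \<bullet> (x - y)\<bar> \<le> L * norm (x - y) ^ 2"
    and L: "L \<ge> 0" and \<epsilon>: "\<epsilon> > 0" "\<epsilon> * (2 * M * (M + 1) * (L + 1)) \<le> 1"
    and F: "\<And>x. x \<in> T \<Longrightarrow> \<bar>F x\<bar> \<le> \<eta>" and G: "\<And>x. x \<in> T \<Longrightarrow> t \<le> norm (G x)"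
    and \<eta>: "0 < \<eta>" "\<eta> \<le> t ^ 2" and t: "0 < t"
    and diam: "\<And>x y. x \<in> T \<Longrightarrow> y \<in> T \<Longrightarrow> dist x y \<le> D * t" and D: "D \<ge> 0"
  obtains key :: "real^'m \<Rightarrow> 'm \<times> ('m \<Rightarrow> int)"
  where "finite (key ` T)"
    "real (card (key ` T)) \<le> M * (2 * D / \<epsilon> + 2) ^ CARD('m) * (t ^ 2 / \<eta>) ^ (CARD('m) - 1)"
    "\<And>x y. x \<in> T \<Longrightarrow> y \<in> T \<Longrightarrow> key x = key y \<Longrightarrow> dist x y \<le> 8 * M * (\<eta> / t)"
proof (cases "T = {}")
  case True
  show ?thesis by (rule that[of "\<lambda>_. undefined"]) (use True D \<epsilon> t \<eta> in \<open>auto simp: M_def\<close>)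
next
  case False
  then obtain z where z: "z \<in> T" by blast
  define r where "r = \<eta> / t"
  have r: "0 < r" "r \<le> t" using \<eta> t by (auto simp: r_def field_simps power2_eq_square)
  have M: "M > 0" by (simp add: M_def)
  have "\<forall>x. \<exists>i. norm (G x) \<le> M * \<bar>G x $ i\<bar> \<and> (\<forall>j. \<bar>G x $ j\<bar> \<le> \<bar>G x $ i\<bar>)"
    unfolding M_def by (metis exists_dominant_coordinate)
  then obtain I where I: "\<And>x. norm (G x) \<le> M * \<bar>G x $ I x\<bar>" "\<And>x j. \<bar>G x $ j\<bar> \<le> \<bar>G x $ I x\<bar>"
    by metis
  define h where "h i j = \<epsilon> * (if j = i then t else r)" for i j :: 'm
  have h: "h i j > 0" for i j using \<epsilon> t r by (simp add: h_def)
  \<comment> \<open>The coarse direction depends on the point. Recording \<open>I x\<close> ensures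
    that points with equal keys lie in the same cell of the same grid.\<close>
  define key where "key x = (I x, \<lambda>j. \<lfloor>x $ j / h (I x) j\<rfloor>)" for x
  define A where "A i j = {\<lfloor>(z $ j - D * t) / h i j\<rfloor>..\<lfloor>(z $ j + D * t) / h i j\<rfloor>}" for i j
  \<comment> \<open>Bounds the number of coarse cells met by an interval of length
    \<open>2 * D * t\<close>. As \<open>t / r \<ge> 1\<close>, the number of fine cells is at most
    \<open>N * (t / r)\<close>, and \<open>t / r\<close> equals
    \<open>t ^ 2 / \<eta>\<close>.\<close>
  define N where "N = 2 * D / \<epsilon> + 2"
  have N: "N \<ge> 1" using D \<epsilon> by (simp add: N_def)
  have sub: "key ` T \<subseteq> Sigma UNIV (\<lambda>i. PiE UNIV (A i))"
  proof
    fix k assume "k \<in> key ` T"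
    then obtain x where x: "x \<in> T" "k = key x" by blast
    have "\<bar>x $ j - z $ j\<bar> \<le> D * t" for j
      using component_le_norm_cart[of "x - z" j] diam[OF x(1) z] by (simp add: dist_norm)
    then have "z $ j - D * t \<le> x $ j" "x $ j \<le> z $ j + D * t" for j by (smt (verit))+
    then have "\<lfloor>x $ j / h i j\<rfloor> \<in> A i j" for i j
      using h[of i j] by (auto simp: A_def intro!: floor_mono divide_right_mono)
    then show "k \<in> Sigma UNIV (\<lambda>i. PiE UNIV (A i))" by (auto simp: x key_def PiE_UNIV_domain)
  qed
  have fin: "finite (Sigma UNIV (\<lambda>i. PiE UNIV (A i)))"
    by (intro finite_SigmaI finite_PiE) (auto simp: A_def)
  have cardA: "real (card (A i j)) \<le> (if j = i then N else N * (t / r))" for i j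
  proof -
    have "real (card (A i j)) \<le> ((z $ j + D * t) - (z $ j - D * t)) / h i j + 2"
      unfolding A_def using h D t by (intro card_floor_interval) auto
    also have "\<dots> = 2 * D * t / h i j + 2" by simp
    also have "\<dots> \<le> (if j = i then N else N * (t / r))"
    proof -
      have "1 \<le> t / r" using r by simp
      then have "2 * D * t / (\<epsilon> * r) + 2 * 1 \<le> 2 * D * t / (\<epsilon> * r) + 2 * (t / r)" by linarith
      also have "\<dots> = N * (t / r)" by (simp add: N_def algebra_simps)
      finally show ?thesis using t by (simp add: h_def N_def)
    qed
    finally show ?thesis .
  qed
  have "real (card (key ` T)) \<le> real (card (Sigma UNIV (\<lambda>i. PiE UNIV (A i))))"
    using card_mono[OF fin sub] by simp
  also have "\<dots> = (\<Sum>i\<in>UNIV. \<Prod>j\<in>UNIV. real (card (A i j)))"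
    by (subst card_SigmaI) (auto simp: card_PiE A_def intro!: finite_PiE)
  also have "\<dots> \<le> (\<Sum>i\<in>(UNIV :: 'm set). N ^ CARD('m) * (t / r) ^ (CARD('m) - 1))"
  proof (rule sum_mono)
    fix i :: 'm
    have "(\<Prod>j\<in>UNIV. real (card (A i j))) \<le> (\<Prod>j\<in>UNIV. if j = i then N else N * (t / r))"
      by (rule prod_mono) (auto simp: cardA[of i])
    also have "\<dots> = N * (N * (t / r)) ^ (CARD('m) - 1)"
      by (subst prod.remove[of _ i]) auto
    also have "\<dots> = N ^ CARD('m) * (t / r) ^ (CARD('m) - 1)"
      by (simp only: power_mult_distrib, cases "CARD('m)") auto
    finally show "(\<Prod>j\<in>UNIV. real (card (A i j))) \<le> N ^ CARD('m) * (t / r) ^ (CARD('m) - 1)" .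
  qed
  also have "\<dots> = M * N ^ CARD('m) * (t ^ 2 / \<eta>) ^ (CARD('m) - 1)"
    by (simp add: M_def r_def power2_eq_square)
  finally have card: "real (card (key ` T)) \<le> M * N ^ CARD('m) * (t ^ 2 / \<eta>) ^ (CARD('m) - 1)" .
  show ?thesis
  proof (rule that)
    show "finite (key ` T)" using finite_subset[OF sub fin] .
    show "real (card (key ` T)) \<le> M * (2 * D / \<epsilon> + 2) ^ CARD('m) * (t ^ 2 / \<eta>) ^ (CARD('m) - 1)"
      using card by (simp add: N_def)
  next
    fix x y assume xy: "x \<in> T" "y \<in> T" and eq: "key x = key y"
    have "\<lfloor>x $ j / h (I x) j\<rfloor> = \<lfloor>y $ j / h (I x) j\<rfloor>" for j
      using eq by (auto simp: key_def fun_eq_iff)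
    then have hj: "\<bar>x $ j - y $ j\<bar> \<le> h (I x) j" for j
      by (rule dist_le_of_floor_eq[OF h])
    have near: "\<bar>x $ I x - y $ I x\<bar> \<le> \<epsilon> * t" "\<And>j. j \<noteq> I x \<Longrightarrow> \<bar>x $ j - y $ j\<bar> \<le> \<epsilon> * r"
      subgoal using hj[of "I x"] by (simp add: h_def)
      subgoal for j using hj[of j] by (simp add: h_def)
      done
    have "norm (x - y) \<le> 8 * M * r"
      by (rule shell_diameter_bound[OF taylor[OF xy] L \<epsilon>[unfolded M_def] F[OF xy(1)] F[OF xy(2)] t
            G[OF xy(1)] \<eta>(1) r_def r(2) I[unfolded M_def] near, folded M_def])
    then show "dist x y \<le> 8 * M * (\<eta> / t)" by (simp add: r_def dist_norm)
  qed
qed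

text \<open>A piece has diameter at most \<open>(8 * M / t) * \<eta>\<close>, so
  \<open>growth\<close> bounds its cost by \<open>c * (8 * M / t) powr s * f \<eta>\<close>.
  Multiplying by the number of pieces leaves \<open>t\<close> in the single power
  \<open>2 * (M - 1) - s\<close>; where this exponent is positive, the costs of dyadic shells decay
  geometrically.\<close>

lemma hausdorff_premeasure_shell:
  fixes T :: "(real^'m) set" and F :: "real^'m \<Rightarrow> real" and G :: "real^'m \<Rightarrow> real^'m"
  defines "M \<equiv> real CARD('m)"
  assumes f: "dimension_function f" and c: "c > 0"
    and growth: "\<And>x y. 0 < y \<Longrightarrow> y < 1 \<Longrightarrow> 1 < x \<Longrightarrow> f (x * y) \<le> c * x powr s * f y"
    and taylor: "\<And>x y. x \<in> T \<Longrightarrow> y \<in> T \<Longrightarrow> \<bar>F x - F y - G x \<bullet> (x - y)\<bar> \<le> L * norm (x - y) ^ 2"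
    and L: "L \<ge> 0" and \<epsilon>: "\<epsilon> > 0" "\<epsilon> * (2 * M * (M + 1) * (L + 1)) \<le> 1"
    and F: "\<And>x. x \<in> T \<Longrightarrow> \<bar>F x\<bar> \<le> \<eta>" and G: "\<And>x. x \<in> T \<Longrightarrow> t \<le> norm (G x)"
    and \<eta>: "0 < \<eta>" "\<eta> \<le> t ^ 2" "\<eta> < 1" and t: "0 < t" "t \<le> 1"
    and diam: "\<And>x y. x \<in> T \<Longrightarrow> y \<in> T \<Longrightarrow> dist x y \<le> D * t" and D: "D \<ge> 0"
    and \<rho>: "8 * M * (\<eta> / t) \<le> \<rho>"
  shows "hausdorff_premeasure f \<rho> T \<le> ennreal (M * (2 * D / \<epsilon> + 2) ^ CARD('m) * c * (8 * M) powr s *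
      t powr (2 * (M - 1) - s) * ((1 / \<eta>) ^ (CARD('m) - 1) * f \<eta>))"
proof -
  have f0: "f 0 = 0" and fmono: "\<And>x y. 0 \<le> x \<Longrightarrow> x \<le> y \<Longrightarrow> f x \<le> f y"
    using f by (auto simp: dimension_function_def mono_on_def)
  have M: "M \<ge> 1" unfolding M_def by (simp add: Suc_leI)
  define K where "K = M * (2 * D / \<epsilon> + 2) ^ CARD('m)"
  have K: "K \<ge> 0" using M D \<epsilon> by (simp add: K_def)
  have f\<eta>: "f \<eta> \<ge> 0" using fmono[of 0 \<eta>] f0 \<eta> by simp
  obtain key :: "real^'m \<Rightarrow> 'm \<times> ('m \<Rightarrow> int)" where key: "finite (key ` T)"
    "real (card (key ` T)) \<le> K * (t ^ 2 / \<eta>) ^ (CARD('m) - 1)"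
    "\<And>x y. x \<in> T \<Longrightarrow> y \<in> T \<Longrightarrow> key x = key y \<Longrightarrow> dist x y \<le> 8 * M * (\<eta> / t)"
    by (rule shell_partition[where T = T and F = F and G = G, OF taylor L \<epsilon>[unfolded M_def] F G \<eta>(1,2) t(1) diam D, folded M_def, folded K_def])
      (assumption+, rule that)
  define P where "P a = {x \<in> T. key x = a}" for a
  have rho0: "\<rho> \<ge> 0" using M \<eta>(1) t(1) by (intro order_trans[OF _ \<rho>]) simp
  have piece: "hausdorff_premeasure f \<rho> (P a) \<le> ennreal (c * (8 * M / t) powr s * f \<eta>)" for a
  proof -
    have le: "dist x y \<le> 8 * M * (\<eta> / t)" if "x \<in> P a" "y \<in> P a" for x y
      using that key(3) by (simp add: P_def)
    then have bd: "bounded (P a)" by (meson bounded_two_points)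
    have d: "diameter (P a) \<le> 8 * M * (\<eta> / t)"
      using le M \<eta> t by (intro diameter_le) (auto simp: dist_norm)
    have "hausdorff_premeasure f \<rho> (P a) \<le> ennreal (f (diameter (P a)))"
      using f0 bd d \<rho> by (intro hausdorff_premeasure_single) auto
    also have "f (diameter (P a)) \<le> f (8 * M / t * \<eta>)"
      using diameter_ge_0[OF bd] d by (intro fmono) simp_all
    also have "\<dots> \<le> c * (8 * M / t) powr s * f \<eta>"
    proof (rule growth[OF \<eta>(1,3)])
      have "t < 8 * M" using t M by linarith
      then show "1 < 8 * M / t" using t(1) by simp
    qed
    finally show ?thesis by (simp add: ennreal_leI)
  qed
  have "hausdorff_premeasure f \<rho> T = hausdorff_premeasure f \<rho> (\<Union>a\<in>key ` T. P a)"
    by (rule arg_cong[where f = "hausdorff_premeasure f \<rho>"]) (auto simp: P_def)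
  also have "\<dots> \<le> (\<Sum>a\<in>key ` T. hausdorff_premeasure f \<rho> (P a))"
    using f0 rho0 key(1) by (intro hausdorff_premeasure_UN_finite)
  also have "\<dots> \<le> (\<Sum>a\<in>key ` T. ennreal (c * (8 * M / t) powr s * f \<eta>))"
    by (intro sum_mono piece)
  also have "\<dots> = ennreal (real (card (key ` T)) * (c * (8 * M / t) powr s * f \<eta>))"
    by (simp only: sum_constant ennreal_of_nat_eq_real_of_nat ennreal_mult'[OF of_nat_0_le_iff])
  also have "\<dots> \<le> ennreal (K * (t ^ 2 / \<eta>) ^ (CARD('m) - 1) * (c * (8 * M / t) powr s * f \<eta>))"
    using key(2) c f\<eta> by (intro ennreal_leI mult_right_mono) auto
  also have "K * (t ^ 2 / \<eta>) ^ (CARD('m) - 1) * (c * (8 * M / t) powr s * f \<eta>)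
      = K * c * (8 * M) powr s * (t ^ (2 * (CARD('m) - 1)) * (1 / t) powr s) * ((1 / \<eta>) ^ (CARD('m) - 1) * f \<eta>)"
  proof -
    have "(8 * M / t) powr s = (8 * M) powr s * (1 / t) powr s"
      using M t(1) powr_mult[of "8 * M" "1 / t" s] by simp
    moreover have "(t ^ 2 / \<eta>) ^ (CARD('m) - 1) = t ^ (2 * (CARD('m) - 1)) * (1 / \<eta>) ^ (CARD('m) - 1)"
      by (simp only: power_mult power_mult_distrib[symmetric]) simp
    ultimately show ?thesis by (simp only: mult_ac)
  qed
  also have "t ^ (2 * (CARD('m) - 1)) * (1 / t) powr s = t powr (2 * (M - 1) - s)"
  proof -
    have "t ^ (2 * (CARD('m) - 1)) = t powr (2 * (M - 1))"
      using t by (subst powr_realpow[symmetric]) (auto simp: M_def of_nat_diff Suc_leI)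
    moreover have "(1 / t) powr s = t powr (- s)" using t by (simp add: powr_divide powr_minus_divide)
    ultimately show ?thesis by (simp add: powr_add[symmetric])
  qed
  finally show ?thesis by (simp add: K_def)
qed

section \<open>Summation over dyadic sizes of the gradient\<close>

lemma ex_halving_exponent:
  fixes \<eta> :: real
  assumes "0 < \<eta>" "\<eta> < 1"
  obtains K :: nat where "\<eta> \<le> ((1/2) ^ K)\<^sup>2" "((1/2) ^ Suc K)\<^sup>2 < \<eta>"
proof -
  \<comment> \<open>The squares of the halving scales are the powers of \<open>1/4\<close>. The
    first of these below \<open>\<eta>\<close> has positive index because \<open>\<eta> < 1\<close>,
    and its predecessor is the wanted \<open>K\<close>.\<close>
  define j where "j = (LEAST j. (1/4 :: real) ^ j < \<eta>)"
  have ex: "\<exists>j. (1/4 :: real) ^ j < \<eta>" using real_arch_pow_inv[of \<eta> "1/4"] assms by simp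
  have j: "(1/4 :: real) ^ j < \<eta>" unfolding j_def by (rule LeastI_ex[OF ex])
  then obtain K where K: "j = Suc K" using assms by (cases j) auto
  have "\<not> (1/4 :: real) ^ K < \<eta>" using not_less_Least[of K "\<lambda>j. (1/4 :: real) ^ j < \<eta>"] K by (simp add: j_def)
  moreover have "((1/2) ^ k)\<^sup>2 = (1/4 :: real) ^ k" for k
    by (simp only: power_mult[symmetric] mult.commute[of k 2]) (simp add: power_mult power_divide)
  ultimately show ?thesis using that[of K] j K by (simp del: power_Suc)
qed

text \<open>\<open>G\<close> plays the role of the gradient of \<open>F\<close>.\<close>

definition separated_gradient_on ::
    "(real^'m) set \<Rightarrow> real \<Rightarrow> real \<Rightarrow> real \<Rightarrow> (real^'m \<Rightarrow> real) \<Rightarrow> (real^'m \<Rightarrow> real^'m) \<Rightarrow> bool"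
  where "separated_gradient_on B L \<kappa> D F G \<longleftrightarrow> (\<forall>x\<in>B. \<forall>y\<in>B.
    \<bar>F x - F y - G x \<bullet> (x - y)\<bar> \<le> L * norm (x - y) ^ 2 \<and>
    \<kappa> * dist x y \<le> norm (G x) + norm (G y) \<and> dist x y \<le> D)"

text \<open>The shells with gradient about \<open>(1/2) ^ k\<close> are summed down to size about
  \<open>sqrt \<eta>\<close>; below that one core set remains. The constant \<open>C\<close> is
  chosen before \<open>B\<close>, \<open>F\<close>, \<open>G\<close> and \<open>\<eta>\<close>,
  which makes the bound uniform over all integer vectors later on.\<close>

lemma hausdorff_premeasure_sublevel:
  fixes f :: "real \<Rightarrow> real"
  defines "M \<equiv> real CARD('m)"
  assumes f: "dimension_function f" and s: "s < 2 * (M - 1)" and c: "c > 0"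
    and growth: "\<And>x y. 0 < y \<Longrightarrow> y < 1 \<Longrightarrow> 1 < x \<Longrightarrow> f (x * y) \<le> c * x powr s * f y"
    and L: "L \<ge> 0" and \<kappa>: "\<kappa> > 0" and D0: "D0 \<ge> 0"
  obtains C where "C > 0"
    "\<And>(B :: (real^'m) set) F G \<eta> \<rho>. separated_gradient_on B L \<kappa> D0 F G \<Longrightarrow>
      0 < \<eta> \<Longrightarrow> \<eta> < 1 \<Longrightarrow> C * sqrt \<eta> \<le> \<rho> \<Longrightarrow>
      hausdorff_premeasure f \<rho> {x \<in> B. \<bar>F x\<bar> < \<eta>} \<le> ennreal (C * ((1 / \<eta>) ^ (CARD('m) - 1) * f \<eta>))"
proof -
  have f0: "f 0 = 0" and fmono: "\<And>x y. 0 \<le> x \<Longrightarrow> x \<le> y \<Longrightarrow> f x \<le> f y"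
    using f by (auto simp: dimension_function_def mono_on_def)
  have M: "M \<ge> 1" unfolding M_def by (simp add: Suc_leI)
  define \<epsilon> where "\<epsilon> = 1 / (2 * M * (M + 1) * (L + 1))"
  have \<epsilon>: "\<epsilon> > 0" "\<epsilon> * (2 * M * (M + 1) * (L + 1)) \<le> 1" using M L by (auto simp: \<epsilon>_def)
  \<comment> \<open>For \<open>k > 0\<close> both gradients in a shell are at most
    \<open>2 * t k\<close>, so separation gives distance at most \<open>4 / \<kappa> * t k\<close>.
    The shell \<open>k = 0\<close> is bounded by \<open>D0\<close>, with
    \<open>t 0 = 1\<close>.\<close>
  define D where "D = max D0 (4 / \<kappa>)"
  have D: "D \<ge> 0" using D0 by (simp add: D_def)
  define A where "A = M * (2 * D / \<epsilon> + 2) ^ CARD('m) * c * (8 * M) powr s"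
  have A: "A \<ge> 0" using M D \<epsilon> c by (simp add: A_def)
  \<comment> \<open>The ratio of the costs of consecutive shells; it is below 1 because
    \<open>s < 2 * (M - 1)\<close>.\<close>
  define \<beta> where "\<beta> = (1/2) powr (2 * (M - 1) - s)"
  have \<beta>: "0 < \<beta>" "\<beta> < 1" using s powr_less_mono2[of "2 * (M - 1) - s" "1/2" 1] by (auto simp: \<beta>_def)
  \<comment> \<open>In the core both gradients are at most \<open>2 * sqrt \<eta>\<close>, so its
    diameter is at most \<open>4 / \<kappa> * sqrt \<eta>\<close>. The summand 2 gives
    \<open>E > 1\<close>, which keeps the scaling factor in \<open>growth\<close> above 1.\<close>
  define E where "E = 4 / \<kappa> + 2"
  have E: "E > 1" using \<kappa> by (simp add: E_def add_pos_pos)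
  \<comment> \<open>The first two summands bound the costs of the shells and of the core;
    \<open>E\<close> and \<open>8 * M\<close> ensure that all pieces have diameter at most
    \<open>C * sqrt \<eta>\<close>.\<close>
  define C where "C = A / (1 - \<beta>) + c * E powr s + E + 8 * M"
  have C: "C > 0" "8 * M \<le> C" "E \<le> C" "A / (1 - \<beta>) + c * E powr s \<le> C"
  proof -
    have "A / (1 - \<beta>) \<ge> 0" "c * E powr s \<ge> 0" using A \<beta> c by auto
    then show "C > 0" "8 * M \<le> C" "E \<le> C" "A / (1 - \<beta>) + c * E powr s \<le> C"
      using E M by (auto simp: C_def)
  qed
  show thesis
  proof (rule that[OF C(1)])
    fix B :: "(real^'m) set" and F G \<eta> \<rho>
    assume nd: "separated_gradient_on B L \<kappa> D0 F G"
      and \<eta>: "0 < \<eta>" "\<eta> < 1" and \<rho>: "C * sqrt \<eta> \<le> \<rho>"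
    have taylor: "\<bar>F x - F y - G x \<bullet> (x - y)\<bar> \<le> L * norm (x - y) ^ 2"
      and sep: "\<kappa> * dist x y \<le> norm (G x) + norm (G y)" and dist: "dist x y \<le> D0"
      if "x \<in> B" "y \<in> B" for x y
      using nd that unfolding separated_gradient_on_def by blast+
    define R where "R = (1 / \<eta>) ^ (CARD('m) - 1) * f \<eta>"
    have f\<eta>: "f \<eta> \<ge> 0" using fmono[of 0 \<eta>] f0 \<eta> by simp
    have R: "R \<ge> 0" using f\<eta> \<eta> by (simp add: R_def)
    have rho0: "\<rho> \<ge> 0" using \<rho> C \<eta> by (smt (verit) mult_nonneg_nonneg real_sqrt_ge_zero)
    obtain K where K: "\<eta> \<le> ((1/2) ^ K)\<^sup>2" "((1/2) ^ Suc K)\<^sup>2 < \<eta>"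
      using ex_halving_exponent[OF \<eta>] .
    define t :: "nat \<Rightarrow> real" where "t k = (1/2) ^ k" for k
    have t: "0 < t k" "t k \<le> 1" for k by (auto simp: t_def power_le_one)
    have tk: "\<eta> \<le> (t k)\<^sup>2" if "k \<le> K" for k
    proof -
      have "t K \<le> t k" using that by (auto simp: t_def intro: power_decreasing)
      then have "(t K)\<^sup>2 \<le> (t k)\<^sup>2" using t[of K] by (intro power_mono) auto
      then show ?thesis using K(1) unfolding t_def by linarith
    qed
    have tK: "t K \<le> 2 * sqrt \<eta>"
    proof -
      have "(t K / 2)\<^sup>2 \<le> \<eta>" using K(2) by (simp add: t_def)
      then have "t K / 2 \<le> sqrt \<eta>" by (rule real_le_rsqrt)
      then show ?thesis by simp
    qed
    \<comment> \<open>The shell \<open>k = 0\<close> has no upper bound on the gradient, so that it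
      takes in all large gradients.\<close>
    define T where "T k = {x \<in> B. \<bar>F x\<bar> < \<eta> \<and> t k \<le> norm (G x) \<and> (k = 0 \<or> norm (G x) \<le> 2 * t k)}" for k
    define Z where "Z = {x \<in> B. \<bar>F x\<bar> < \<eta> \<and> norm (G x) \<le> t K}"
    have cover: "{x \<in> B. \<bar>F x\<bar> < \<eta>} \<subseteq> Z \<union> (\<Union>k\<in>{..K}. T k)"
    proof
      fix x assume x: "x \<in> {x \<in> B. \<bar>F x\<bar> < \<eta>}"
      show "x \<in> Z \<union> (\<Union>k\<in>{..K}. T k)"
      proof (cases "norm (G x) \<le> t K")
        case True
        then show ?thesis using x by (simp add: Z_def)
      next
        case False
        define k where "k = (LEAST k. t k \<le> norm (G x))"
        have k: "t k \<le> norm (G x)" "k \<le> K"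
          unfolding k_def using False by (auto intro: LeastI[of _ K] Least_le)
        have "norm (G x) \<le> 2 * t k" if k0: "k \<noteq> 0"
        proof -
          obtain k' where k': "k = Suc k'" using k0 by (cases k) auto
          then have "\<not> t k' \<le> norm (G x)" unfolding k_def by (metis lessI not_less_Least)
          then show ?thesis by (simp add: k' t_def)
        qed
        then show ?thesis using x k by (auto simp: T_def)
      qed
    qed
    have T: "hausdorff_premeasure f \<rho> (T k) \<le> ennreal (A * \<beta> ^ k * R)" if k: "k \<le> K" for k
    proof -
      have "hausdorff_premeasure f \<rho> (T k) \<le> ennreal (M * (2 * D / \<epsilon> + 2) ^ CARD('m) * c * (8 * M) powr s *
          t k powr (2 * (M - 1) - s) * ((1 / \<eta>) ^ (CARD('m) - 1) * f \<eta>))"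
        unfolding M_def
      proof (rule hausdorff_premeasure_shell[OF f c growth taylor L \<epsilon>[unfolded M_def] _ _ \<eta>(1) tk[OF k] \<eta>(2) t[of k] _ D])
        fix x y assume xy: "x \<in> T k" "y \<in> T k"
        show "dist x y \<le> D * t k"
        proof (cases "k = 0")
          case True
          then show ?thesis using dist[of x y] xy by (simp add: T_def t_def D_def)
        next
          case False
          then have "\<kappa> * dist x y \<le> 4 * t k" using sep[of x y] xy by (simp add: T_def)
          then have "dist x y \<le> 4 / \<kappa> * t k" using \<kappa> by (simp add: field_simps)
          also have "\<dots> \<le> D * t k" using t[of k] by (intro mult_right_mono) (auto simp: D_def)
          finally show ?thesis .
        qed
      next
        have "\<eta> / t k \<le> sqrt \<eta>"
        proof -
          have "sqrt \<eta> \<le> t k" using tk[OF k] t[of k] by (simp add: real_le_lsqrt)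
          then have "sqrt \<eta> * sqrt \<eta> \<le> sqrt \<eta> * t k" using \<eta> by (intro mult_left_mono) auto
          then show ?thesis using \<eta> t[of k] by (simp add: field_simps)
        qed
        then have "8 * M * (\<eta> / t k) \<le> C * sqrt \<eta>" using C M \<eta> t[of k] by (intro mult_mono) auto
        then show "8 * real CARD('m) * (\<eta> / t k) \<le> \<rho>" using \<rho> by (simp add: M_def)
      qed (auto simp: T_def)
      also have "t k powr (2 * (M - 1) - s) = \<beta> ^ k"
        unfolding t_def \<beta>_def by (simp add: powr_realpow[symmetric] powr_powr mult.commute)
      finally show ?thesis by (simp add: A_def R_def)
    qed
    have Z: "hausdorff_premeasure f \<rho> Z \<le> ennreal (c * E powr s * R)"
    proof -
      have le: "dist x y \<le> E * sqrt \<eta>" if "x \<in> Z" "y \<in> Z" for x y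
      proof -
        have "\<kappa> * dist x y \<le> 4 * sqrt \<eta>" using sep[of x y] that tK by (simp add: Z_def)
        then have "dist x y \<le> 4 / \<kappa> * sqrt \<eta>" using \<kappa> by (simp add: field_simps)
        also have "\<dots> \<le> E * sqrt \<eta>" using \<eta> by (intro mult_right_mono) (auto simp: E_def)
        finally show ?thesis .
      qed
      then have bd: "bounded Z" by (meson bounded_two_points)
      have d: "diameter Z \<le> E * sqrt \<eta>"
        using le E \<eta> by (intro diameter_le) (auto simp: dist_norm)
      have "E * sqrt \<eta> \<le> \<rho>"
        using C(3) \<eta> by (intro order_trans[OF _ \<rho>] mult_right_mono) auto
      then have "hausdorff_premeasure f \<rho> Z \<le> ennreal (f (diameter Z))"
        using f0 bd d by (intro hausdorff_premeasure_single) auto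
      \<comment> \<open>Writing \<open>sqrt \<eta>\<close> as
        \<open>(1 / sqrt \<eta>) * \<eta>\<close> lets \<open>growth\<close> compare with
        \<open>f \<eta>\<close>, the value in the target bound.\<close>
      also have "f (diameter Z) \<le> f ((E * (1 / sqrt \<eta>)) * \<eta>)"
      proof (rule fmono)
        have "(E * (1 / sqrt \<eta>)) * \<eta> = E * sqrt \<eta>" using \<eta> by (simp add: field_simps)
        then show "diameter Z \<le> (E * (1 / sqrt \<eta>)) * \<eta>" using d by simp
      qed (rule diameter_ge_0[OF bd])
      also have "\<dots> \<le> c * (E * (1 / sqrt \<eta>)) powr s * f \<eta>"
      proof (rule growth[OF \<eta>])
        have "1 < 1 / sqrt \<eta>" using \<eta> by simp
        then show "1 < E * (1 / sqrt \<eta>)" using E by (metis less_1_mult)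
      qed
      also have "(E * (1 / sqrt \<eta>)) powr s = E powr s * (1 / sqrt \<eta>) powr s"
        using E \<eta> by (subst powr_mult) auto
      \<comment> \<open>The second use of \<open>s < 2 * (M - 1)\<close>: raising the exponent of
        the base \<open>1 / sqrt \<eta> \<ge> 1\<close> to \<open>2 * (M - 1)\<close> produces the
        same power of \<open>1 / \<eta>\<close> as for the shells.\<close>
      also have "c * (E powr s * (1 / sqrt \<eta>) powr s) * f \<eta> \<le> c * (E powr s * (1 / \<eta>) ^ (CARD('m) - 1)) * f \<eta>"
      proof -
        have "(1 / sqrt \<eta>) powr s \<le> (1 / sqrt \<eta>) powr (2 * (M - 1))"
          using \<eta> s by (intro powr_mono) auto
        also have "\<dots> = (1 / sqrt \<eta>) ^ (2 * (CARD('m) - 1))"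
          using \<eta> by (subst powr_realpow[symmetric]) (auto simp: M_def of_nat_diff Suc_leI)
        also have "\<dots> = (1 / \<eta>) ^ (CARD('m) - 1)"
          using \<eta> by (simp add: power_mult power_divide)
        finally show ?thesis using c f\<eta> by (intro mult_right_mono mult_left_mono) auto
      qed
      finally show ?thesis by (simp add: R_def ennreal_leI mult_ac)
    qed
    have "hausdorff_premeasure f \<rho> {x \<in> B. \<bar>F x\<bar> < \<eta>} \<le> hausdorff_premeasure f \<rho> (Z \<union> (\<Union>k\<in>{..K}. T k))"
      by (rule hausdorff_premeasure_mono[OF cover])
    also have "\<dots> \<le> hausdorff_premeasure f \<rho> Z + hausdorff_premeasure f \<rho> (\<Union>k\<in>{..K}. T k)"
      by (rule hausdorff_premeasure_Un[OF _ rho0]) (rule f0)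
    also have "\<dots> \<le> hausdorff_premeasure f \<rho> Z + (\<Sum>k\<le>K. hausdorff_premeasure f \<rho> (T k))"
      by (intro add_left_mono hausdorff_premeasure_UN_finite f0 rho0) auto
    also have "\<dots> \<le> ennreal (c * E powr s * R) + (\<Sum>k\<le>K. ennreal (A * \<beta> ^ k * R))"
      by (intro add_mono sum_mono Z T) auto
    also have "\<dots> = ennreal (c * E powr s * R + (\<Sum>k\<le>K. A * \<beta> ^ k * R))"
      using A R \<beta> c by (subst sum_ennreal) (auto simp: ennreal_plus[symmetric] sum_nonneg simp del: ennreal_plus)
    also have "\<dots> \<le> ennreal (C * R)"
    proof (rule ennreal_leI)
      have "(\<Sum>k\<le>K. A * \<beta> ^ k * R) = A * R * (\<Sum>k\<le>K. \<beta> ^ k)"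
        by (simp add: sum_distrib_left mult_ac)
      also have "\<dots> \<le> A * R * (1 / (1 - \<beta>))"
      proof (intro mult_left_mono)
        have "(\<Sum>k\<le>K. \<beta> ^ k) \<le> (\<Sum>k. \<beta> ^ k)"
          using \<beta> by (intro sum_le_suminf summable_geometric) auto
        then show "(\<Sum>k\<le>K. \<beta> ^ k) \<le> 1 / (1 - \<beta>)" using \<beta> by (simp add: suminf_geometric)
      qed (use A R in auto)
      finally have "c * E powr s * R + (\<Sum>k\<le>K. A * \<beta> ^ k * R) \<le> (A / (1 - \<beta>) + c * E powr s) * R"
        by (simp add: algebra_simps)
      also have "\<dots> \<le> C * R" using C(4) R by (rule mult_right_mono)
      finally show "c * E powr s * R + (\<Sum>k\<le>K. A * \<beta> ^ k * R) \<le> C * R" .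
    qed
    finally show "hausdorff_premeasure f \<rho> {x \<in> B. \<bar>F x\<bar> < \<eta>} \<le> ennreal (C * ((1 / \<eta>) ^ (CARD('m) - 1) * f \<eta>))"
      by (simp add: R_def)
  qed
qed

section \<open>Local bounds for twice differentiable functions\<close>

text \<open>On an open set the derivative within \<open>U\<close> is the full derivative, and a
  linear functional is determined by its values on the axis vectors, which \<open>gradient\<close>
  collects.\<close>

lemma C2_onD:
  assumes "C2_on U g" "open U"
  shows "x \<in> U \<Longrightarrow> (g has_derivative (\<lambda>h. gradient g x \<bullet> h)) (at x)"
    and "x \<in> U \<Longrightarrow> (gradient g has_derivative (\<lambda>h. hessian g x *v h)) (at x)"
    and "continuous_on U (hessian g)"
proof -
  show "continuous_on U (hessian g)" using assms by (simp add: C2_on_def)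
  assume x: "x \<in> U"
  have at: "at x within U = at x" by (rule at_within_open[OF x assms(2)])
  have "g differentiable (at x)" using assms(1) x at unfolding C2_on_def differentiable_on_def by metis
  then have der: "(g has_derivative frechet_derivative g (at x)) (at x)"
    by (simp only: frechet_derivative_works[symmetric])
  have "frechet_derivative g (at x) = (\<lambda>h. gradient g x \<bullet> h)"
  proof
    fix h :: "real^'a"
    interpret linear "frechet_derivative g (at x)"
      using der by (rule has_derivative_linear)
    have "frechet_derivative g (at x) h = frechet_derivative g (at x) (\<Sum>i\<in>UNIV. h $ i *\<^sub>R axis i 1)"
      by (simp add: basis_expansion[of h, unfolded scalar_mult_eq_scaleR])
    also have "\<dots> = gradient g x \<bullet> h"
      by (simp add: sum scale gradient_def inner_vec_def mult.commute)
    finally show "frechet_derivative g (at x) h = gradient g x \<bullet> h" .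
  qed
  with der show "(g has_derivative (\<lambda>h. gradient g x \<bullet> h)) (at x)" by simp
  have "gradient g differentiable (at x)" using assms(1) x at unfolding C2_on_def differentiable_on_def by metis
  then show "(gradient g has_derivative (\<lambda>h. hessian g x *v h)) (at x)"
    unfolding hessian_def jacobian_works .
qed

lemma norm_matrix_vector_mult_le:
  fixes A :: "real^'m^'k"
  shows "norm (A *v x) \<le> real CARD('k) * norm A * norm x"
proof -
  have "norm (A *v x) \<le> (\<Sum>i\<in>UNIV. \<bar>(A *v x) $ i\<bar>)" by (rule norm_le_l1_cart)
  also have "\<dots> \<le> (\<Sum>i\<in>(UNIV :: 'k set). norm A * norm x)"
  proof (rule sum_mono)
    fix i
    have "\<bar>(A *v x) $ i\<bar> \<le> norm (A $ i) * norm x"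
      unfolding matrix_vector_mul_component by (rule Cauchy_Schwarz_ineq2)
    also have "\<dots> \<le> norm A * norm x" by (intro mult_right_mono Finite_Cartesian_Product.norm_nth_le) auto
    finally show "\<bar>(A *v x) $ i\<bar> \<le> norm A * norm x" .
  qed
  finally show ?thesis by (simp add: mult.assoc)
qed

text \<open>The mean value inequality on the segment, applied to
  \<open>F z - G x \<bullet> z\<close>: the gradient of this function is \<open>G z - G x\<close>,
  of norm at most \<open>L * norm (x - y)\<close> there.\<close>

lemma quadratic_taylor_bound:
  fixes F :: "'a::euclidean_space \<Rightarrow> real"
  assumes S: "convex S" and "x \<in> S" "y \<in> S"
    and der: "\<And>z. z \<in> S \<Longrightarrow> (F has_derivative (\<lambda>h. G z \<bullet> h)) (at z within S)"
    and lip: "\<And>y z. y \<in> S \<Longrightarrow> z \<in> S \<Longrightarrow> norm (G y - G z) \<le> L * norm (y - z)" and L: "L \<ge> 0"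
  shows "\<bar>F x - F y - G x \<bullet> (x - y)\<bar> \<le> L * norm (x - y) ^ 2"
proof -
  let ?S = "closed_segment x y"
  have sub: "?S \<subseteq> S" using closed_segment_subset assms by blast
  have "norm ((F x - G x \<bullet> x) - (F y - G x \<bullet> y)) \<le> L * norm (x - y) * norm (x - y)"
  proof (rule differentiable_bound[of ?S])
    fix z assume z: "z \<in> ?S"
    then have zS: "z \<in> S" using sub by blast
    have "((\<lambda>z. F z - G x \<bullet> z) has_derivative (\<lambda>h. G z \<bullet> h - G x \<bullet> h)) (at z within S)"
      by (intro has_derivative_diff der[OF zS] bounded_linear_imp_has_derivative bounded_linear_inner_right)
    then show "((\<lambda>z. F z - G x \<bullet> z) has_derivative (\<lambda>h. G z \<bullet> h - G x \<bullet> h)) (at z within ?S)"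
      by (rule has_derivative_subset[OF _ sub])
    show "onorm (\<lambda>h. G z \<bullet> h - G x \<bullet> h) \<le> L * norm (x - y)"
    proof (rule onorm_bound)
      have "norm (G z - G x) \<le> L * norm (z - x)" using lip zS assms by blast
      also have "\<dots> \<le> L * norm (x - y)"
        using segment_bound(1)[OF z] L by (intro mult_left_mono) (auto simp: norm_minus_commute)
      finally have b: "norm (G z - G x) \<le> L * norm (x - y)" .
      show "norm (G z \<bullet> h - G x \<bullet> h) \<le> L * norm (x - y) * norm h" for h
      proof -
        have "norm (G z \<bullet> h - G x \<bullet> h) \<le> norm (G z - G x) * norm h"
          by (simp add: inner_diff_left[symmetric] Cauchy_Schwarz_ineq2)
        also have "\<dots> \<le> L * norm (x - y) * norm h" using b by (rule mult_right_mono) simp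
        finally show ?thesis .
      qed
    qed (use L in auto)
  qed auto
  moreover have "(F x - G x \<bullet> x) - (F y - G x \<bullet> y) = F x - F y - G x \<bullet> (x - y)"
    by (simp add: inner_diff_right)
  ultimately show ?thesis by (simp add: power2_eq_square mult.assoc)
qed

text \<open>Compactness of the closed ball bounds the function, its gradient and its Hessian; the
  last bound makes the gradient Lipschitz.\<close>

lemma C2_on_local_bounds:
  fixes g :: "real^'m \<Rightarrow> real"
  assumes C2: "C2_on U g" and U: "open U" and sub: "cball x0 \<delta> \<subseteq> U"
  obtains R where "R > 0"
    "\<And>x. x \<in> cball x0 \<delta> \<Longrightarrow> \<bar>g x\<bar> \<le> R" "\<And>x. x \<in> cball x0 \<delta> \<Longrightarrow> norm (gradient g x) \<le> R"
    "\<And>x y. x \<in> cball x0 \<delta> \<Longrightarrow> y \<in> cball x0 \<delta> \<Longrightarrow> norm (gradient g x - gradient g y) \<le> R * norm (x - y)"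
proof -
  let ?B = "cball x0 \<delta>"
  note D = C2_onD[OF C2 U]
  have bdd: "\<exists>b>0. \<forall>x\<in>?B. norm (h x) \<le> b" if "continuous_on U h" for h :: "real^'m \<Rightarrow> 'b::real_normed_vector"
  proof -
    have "bounded (h ` ?B)"
      using that sub by (intro compact_imp_bounded compact_continuous_image continuous_on_subset[OF that]) auto
    then show ?thesis by (auto simp: bounded_pos)
  qed
  have cont: "continuous_on U g" "continuous_on U (gradient g)"
    using D(1,2) by (auto intro!: continuous_at_imp_continuous_on has_derivative_continuous)
  obtain a where a: "a > 0" "\<And>x. x \<in> ?B \<Longrightarrow> norm (g x) \<le> a" using bdd[OF cont(1)] by blast
  obtain b where b: "b > 0" "\<And>x. x \<in> ?B \<Longrightarrow> norm (gradient g x) \<le> b" using bdd[OF cont(2)] by blast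
  obtain c where c: "c > 0" "\<And>x. x \<in> ?B \<Longrightarrow> norm (hessian g x) \<le> c" using bdd[OF D(3)] by blast
  define R where "R = a + b + real CARD('m) * c"
  have mc: "real CARD('m) * c > 0" using c(1) by simp
  show thesis
  proof (rule that[of R])
    show R: "R > 0" using a(1) b(1) mc unfolding R_def by linarith
    show "\<bar>g x\<bar> \<le> R" if "x \<in> ?B" for x using a(2)[OF that] b(1) mc unfolding R_def real_norm_def by linarith
    show "norm (gradient g x) \<le> R" if "x \<in> ?B" for x using b(2)[OF that] a(1) mc unfolding R_def by linarith
    show "norm (gradient g x - gradient g y) \<le> R * norm (x - y)" if "x \<in> ?B" "y \<in> ?B" for x y
    proof (rule differentiable_bound[of ?B])
      fix z assume z: "z \<in> ?B"
      then show "(gradient g has_derivative (\<lambda>h. hessian g z *v h)) (at z within ?B)"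
        using D(2) sub by (meson has_derivative_at_withinI subsetD)
      show "onorm ((*v) (hessian g z)) \<le> R"
      proof (rule onorm_bound)
        fix h :: "real^'m"
        have "norm (hessian g z *v h) \<le> real CARD('m) * norm (hessian g z) * norm h"
          by (rule norm_matrix_vector_mult_le)
        also have "\<dots> \<le> R * norm h"
        proof (rule mult_right_mono)
          have "real CARD('m) * norm (hessian g z) \<le> real CARD('m) * c"
            using c(2)[OF z] by (intro mult_left_mono) auto
          then show "real CARD('m) * norm (hessian g z) \<le> R"
            using a(1) b(1) unfolding R_def by linarith
        qed auto
        finally show "norm (hessian g z *v h) \<le> R * norm h" .
      qed (use R in auto)
    qed (use that in auto)
  qed
qed

text \<open>The Hessian at \<open>x0\<close> is bounded below by some \<open>k > 0\<close>. Near
  \<open>x0\<close> the gradient minus this linear map is Lipschitz with constant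
  \<open>k / 2\<close>, by continuity of the Hessian, so a lower bound \<open>k / 2\<close>
  remains.\<close>

lemma gradient_bilipschitz_near_nonsingular:
  fixes g :: "real^'m \<Rightarrow> real"
  assumes C2: "C2_on U g" and U: "open U" and x0: "x0 \<in> U" "invertible (hessian g x0)"
  obtains \<delta> \<kappa> where "\<delta> > 0" "\<kappa> > 0" "cball x0 \<delta> \<subseteq> U"
    "\<And>x y. x \<in> cball x0 \<delta> \<Longrightarrow> y \<in> cball x0 \<delta> \<Longrightarrow> \<kappa> * norm (x - y) \<le> norm (gradient g x - gradient g y)"
proof -
  note D = C2_onD[OF C2 U]
  let ?H = "hessian g x0" and ?M = "real CARD('m)"
  have M: "?M > 0" by simp
  have "inj ((*v) ?H)" using x0(2) by (rule inj_matrix_vector_mult)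
  then obtain k where k: "k > 0" "\<And>v. k * norm v \<le> norm (?H *v v)"
    using linear_inj_bounded_below_pos[OF matrix_vector_mul_linear] by blast
  have "continuous (at x0) (hessian g)" using D(3) x0(1) U by (simp add: continuous_on_eq_continuous_at)
  then obtain d where d: "d > 0" "\<And>x. dist x x0 < d \<Longrightarrow> dist (hessian g x) ?H < k / (2 * ?M)"
  proof -
    have "k / (2 * ?M) > 0" using k(1) M by simp
    then show ?thesis using \<open>continuous (at x0) (hessian g)\<close> that unfolding continuous_at_eps_delta by blast
  qed
  obtain e where e: "e > 0" "cball x0 e \<subseteq> U" using U x0(1) open_contains_cball by blast
  define \<delta> where "\<delta> = min (d/2) e"
  let ?B = "cball x0 \<delta>"
  have B: "?B \<subseteq> U" using e by (auto simp: \<delta>_def)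
  show thesis
  proof (rule that[of \<delta> "k / 2"])
    show "\<delta> > 0" "k / 2 > 0" using d e k by (auto simp: \<delta>_def)
    show "?B \<subseteq> U" by (rule B)
    fix x y assume xy: "x \<in> ?B" "y \<in> ?B"
    have "norm ((gradient g x - ?H *v x) - (gradient g y - ?H *v y)) \<le> k / 2 * norm (x - y)"
    proof (rule differentiable_bound[of ?B])
      fix z assume z: "z \<in> ?B"
      then have "(gradient g has_derivative (\<lambda>h. hessian g z *v h)) (at z within ?B)"
        using D(2) B by (meson has_derivative_at_withinI subsetD)
      then show "((\<lambda>z. gradient g z - ?H *v z) has_derivative (\<lambda>h. hessian g z *v h - ?H *v h)) (at z within ?B)"
        by (intro has_derivative_diff bounded_linear_imp_has_derivative matrix_vector_mul_bounded_linear)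
      show "onorm (\<lambda>h. hessian g z *v h - ?H *v h) \<le> k / 2"
      proof (rule onorm_bound)
        fix h :: "real^'m"
        have "norm (hessian g z *v h - ?H *v h) = norm ((hessian g z - ?H) *v h)"
          by (simp add: matrix_vector_mult_diff_rdistrib)
        also have "\<dots> \<le> ?M * norm (hessian g z - ?H) * norm h"
          by (rule norm_matrix_vector_mult_le)
        also have "\<dots> \<le> k / 2 * norm h"
        proof (rule mult_right_mono)
          have "dist z x0 < d" using z d by (auto simp: \<delta>_def dist_commute)
          then have "norm (hessian g z - ?H) \<le> k / (2 * ?M)" using d(2) by (simp add: dist_norm less_imp_le)
          then have "?M * norm (hessian g z - ?H) \<le> ?M * (k / (2 * ?M))" by (intro mult_left_mono) auto
          then show "?M * norm (hessian g z - ?H) \<le> k / 2" using M by simp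
        qed auto
        finally show "norm (hessian g z *v h - ?H *v h) \<le> k / 2 * norm h" .
      qed (use k in auto)
    qed (use xy in auto)
    moreover have "(gradient g x - ?H *v x) - (gradient g y - ?H *v y) = (gradient g x - gradient g y) - ?H *v (x - y)"
      by (simp add: matrix_vector_mult_diff_distrib)
    moreover have "norm (?H *v (x - y)) - norm (gradient g x - gradient g y) \<le> norm ((gradient g x - gradient g y) - ?H *v (x - y))"
      by (metis norm_minus_commute norm_triangle_ineq2)
    ultimately show "k / 2 * norm (x - y) \<le> norm (gradient g x - gradient g y)"
      using k(2)[of "x - y"] by simp
  qed
qed

section \<open>Integer vectors and the functions attached to them\<close>

definition real_vec :: "(int^'m) \<times> int \<Rightarrow> real^'m"
  where "real_vec q = (\<chi> i. real_of_int (fst q $ i))"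

lemma int_dot_eq: "int_dot q (x, y) = real_vec q \<bullet> x + real_of_int (snd q) * y"
  by (simp add: int_dot_def real_vec_def inner_vec_def)

lemma sup_norm_bounds:
  shows "\<bar>real_of_int (snd q)\<bar> \<le> sup_norm q" "\<bar>real_vec q $ i\<bar> \<le> sup_norm q"
proof -
  let ?A = "insert \<bar>snd q\<bar> (range (\<lambda>i. \<bar>fst q $ i\<bar>))"
  have "finite ?A" "\<bar>snd q\<bar> \<in> ?A" "\<bar>fst q $ i\<bar> \<in> ?A" by simp_all
  then have "\<bar>snd q\<bar> \<le> Max ?A" "\<bar>fst q $ i\<bar> \<le> Max ?A" by (blast intro: Max_ge)+
  then show "\<bar>real_of_int (snd q)\<bar> \<le> sup_norm q" "\<bar>real_vec q $ i\<bar> \<le> sup_norm q"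
    unfolding sup_norm_def real_vec_def vec_lambda_beta of_int_abs[symmetric] of_int_le_iff .
qed

lemma sup_norm_attained:
  assumes "\<bar>real_of_int (snd q)\<bar> < sup_norm q"
  obtains i where "\<bar>real_vec q $ i\<bar> = sup_norm q"
proof -
  let ?A = "insert \<bar>snd q\<bar> (range (\<lambda>i. \<bar>fst q $ i\<bar>))"
  have "Max ?A \<in> ?A" by (rule Max_in) auto
  moreover have "Max ?A \<noteq> \<bar>snd q\<bar>" using assms unfolding sup_norm_def by linarith
  ultimately obtain i where "Max ?A = \<bar>fst q $ i\<bar>" by blast
  then have "\<bar>real_vec q $ i\<bar> = sup_norm q"
    unfolding sup_norm_def real_vec_def by (simp only: vec_lambda_beta of_int_abs)
  then show thesis by (rule that)
qed

lemma norm_real_vec_le: "norm (real_vec q :: real^'m) \<le> real CARD('m) * sup_norm q"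
proof -
  have "norm (real_vec q :: real^'m) \<le> (\<Sum>i\<in>UNIV. \<bar>real_vec q $ i\<bar>)" by (rule norm_le_l1_cart)
  also have "\<dots> \<le> real CARD('m) * sup_norm q"
    using sum_bounded_above[of UNIV "\<lambda>i. \<bar>real_vec q $ i\<bar>" "sup_norm q"] sup_norm_bounds(2)[of q] by simp
  finally show ?thesis .
qed

lemma sup_norm_nonneg: "0 \<le> sup_norm q"
  using sup_norm_bounds(1)[of q] by linarith

text \<open>Lets a statement about all sufficiently large \<open>q\<close> be read as one about all
  but finitely many \<open>q\<close>.\<close>

lemma finite_sup_norm_le: "finite {q :: (int^'m) \<times> int. sup_norm q \<le> N}"
proof -
  let ?I = "{- \<lfloor>N\<rfloor>..\<lfloor>N\<rfloor>}"
  have "{q :: (int^'m) \<times> int. sup_norm q \<le> N} \<subseteq> (\<lambda>(v, k). (vec_lambda v, k)) ` (PiE UNIV (\<lambda>_. ?I) \<times> ?I)"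
  proof
    fix q :: "(int^'m) \<times> int" assume "q \<in> {q. sup_norm q \<le> N}"
    then have N: "sup_norm q \<le> N" by simp
    have "\<bar>real_of_int (snd q)\<bar> \<le> N" using sup_norm_bounds(1)[of q] N by linarith
    then have "snd q \<in> ?I" by (auto simp: le_floor_iff) linarith+
    moreover have "fst q $ i \<in> ?I" for i
    proof -
      have "\<bar>real_of_int (fst q $ i)\<bar> \<le> N" using sup_norm_bounds(2)[of q i] N by (simp add: real_vec_def)
      then show ?thesis by (auto simp: le_floor_iff) linarith+
    qed
    ultimately have "(vec_nth (fst q), snd q) \<in> PiE UNIV (\<lambda>_. ?I) \<times> ?I" by auto
    moreover have "q = (\<lambda>(v, k). (vec_lambda v, k)) (vec_nth (fst q), snd q)" by (simp add: vec_nth_inverse)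
    ultimately show "q \<in> (\<lambda>(v, k). (vec_lambda v, k)) ` (PiE UNIV (\<lambda>_. ?I) \<times> ?I)" by blast
  qed
  moreover have "finite (PiE (UNIV :: 'm set) (\<lambda>_. ?I) \<times> ?I)" by (intro finite_cartesian_product finite_PiE) auto
  ultimately show ?thesis using finite_surj by blast
qed

text \<open>In the application \<open>ux\<close>, \<open>wx\<close> are the gradients at
  \<open>x\<close> of \<open>g\<close> and of \<theta> along the graph. The constant part
  \<open>a\<close> cancels, and dividing by \<open>Q \<ge> \<bar>b\<bar>\<close> makes the constant
  independent of the integer vector.\<close>

lemma normalized_gradient_lipschitz:
  fixes a ux uy wx wy x y :: "'a::real_normed_vector"
  assumes "Q \<ge> 1" "\<bar>b\<bar> \<le> Q" "R \<ge> 0"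
    and "norm (ux - uy) \<le> R * norm (x - y)" "norm (wx - wy) \<le> R * norm (x - y)"
  shows "norm ((1 / Q) *\<^sub>R (a + b *\<^sub>R ux - wx) - (1 / Q) *\<^sub>R (a + b *\<^sub>R uy - wy)) \<le> 2 * R * norm (x - y)"
proof -
  have "(1 / Q) *\<^sub>R (a + b *\<^sub>R ux - wx) - (1 / Q) *\<^sub>R (a + b *\<^sub>R uy - wy) = (1 / Q) *\<^sub>R (b *\<^sub>R (ux - uy) - (wx - wy))"
    by (simp add: algebra_simps)
  also have "norm \<dots> \<le> (1 / Q) * (2 * R * norm (x - y) * Q)"
  proof -
    have "norm (b *\<^sub>R (ux - uy) - (wx - wy)) \<le> \<bar>b\<bar> * norm (ux - uy) + norm (wx - wy)"
      using norm_triangle_ineq4[of "b *\<^sub>R (ux - uy)" "wx - wy"] by simp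
    also have "\<dots> \<le> Q * (R * norm (x - y)) + 1 * (R * norm (x - y))"
      using assms by (intro add_mono mult_mono) auto
    also have "\<dots> \<le> Q * (R * norm (x - y)) + Q * (R * norm (x - y))"
      using assms by (intro add_left_mono mult_right_mono) auto
    finally have "norm (b *\<^sub>R (ux - uy) - (wx - wy)) \<le> 2 * R * norm (x - y) * Q" by (simp add: mult_ac)
    then show ?thesis using assms(1) by (simp only: norm_scaleR) (intro mult_mono, auto)
  qed
  finally show ?thesis using assms(1) by simp
qed

text \<open>A dichotomy at \<open>\<bar>b\<bar> = Q / (4 * R)\<close>. Above it, the difference of
  the two gradients inherits the lower Lipschitz bound of \<open>ux - uy\<close>. Below it,
  \<open>a\<close> has a coordinate of size \<open>Q\<close> which the remaining terms cannot
  cancel, so the first gradient alone has norm at least \<open>1 / 2\<close>.\<close>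

lemma normalized_gradient_separation:
  fixes a ux uy wx wy x y :: "real^'m"
  assumes R: "R \<ge> 1" and \<kappa>0: "\<kappa>0 > 0" and \<delta>: "\<delta> > 0" and Q: "Q \<ge> 4 * R + 8 * R ^ 2 / \<kappa>0"
    and b: "\<bar>b\<bar> \<le> Q" "\<bar>b\<bar> < Q \<Longrightarrow> \<exists>i. \<bar>a $ i\<bar> = Q"
    and u: "norm ux \<le> R" "\<kappa>0 * norm (x - y) \<le> norm (ux - uy)"
    and w: "norm wx \<le> R" "norm (wx - wy) \<le> R * norm (x - y)"
    and xy: "norm (x - y) \<le> 2 * \<delta>"
    and \<kappa>: "\<kappa> \<le> \<kappa>0 / (8 * R)" "\<kappa> \<le> 1 / (4 * \<delta>)"
  shows "\<kappa> * norm (x - y) \<le> norm ((1 / Q) *\<^sub>R (a + b *\<^sub>R ux - wx)) + norm ((1 / Q) *\<^sub>R (a + b *\<^sub>R uy - wy))"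
    (is "_ \<le> norm ?Gx + norm ?Gy")
proof (cases "\<bar>b\<bar> \<ge> Q / (4 * R)")
  case True
  have Q8: "Q \<ge> 8 * R ^ 2 / \<kappa>0" and "Q \<ge> 4 * R"
  proof -
    have "8 * R ^ 2 / \<kappa>0 \<ge> 0" using \<kappa>0 by simp
    then show "Q \<ge> 4 * R" "Q \<ge> 8 * R ^ 2 / \<kappa>0" using Q R by linarith+
  qed
  have Q0: "Q > 0" using \<open>Q \<ge> 4 * R\<close> R by linarith
  have "Q * \<kappa>0 / (4 * R) * norm (x - y) \<le> \<bar>b\<bar> * norm (ux - uy)"
  proof -
    have "Q / (4 * R) * (\<kappa>0 * norm (x - y)) \<le> \<bar>b\<bar> * norm (ux - uy)"
      using True u \<kappa>0 by (intro mult_mono) auto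
    then show ?thesis by simp
  qed
  also have "\<dots> \<le> norm (b *\<^sub>R (ux - uy) - (wx - wy)) + norm (wx - wy)"
    using norm_triangle_sub[of "b *\<^sub>R (ux - uy)" "wx - wy"] by simp
  also have "b *\<^sub>R (ux - uy) - (wx - wy) = (a + b *\<^sub>R ux - wx) - (a + b *\<^sub>R uy - wy)"
    by (simp add: algebra_simps)
  also have "norm \<dots> = Q * norm (?Gx - ?Gy)"
    using Q0 by (simp add: scaleR_diff_right[symmetric])
  \<comment> \<open>As \<open>Q\<close> is at least \<open>8 * R ^ 2 / \<kappa>0\<close>, the
    contribution of \<open>wx - wy\<close> uses up only half of the gain.\<close>
  also have "Q * norm (?Gx - ?Gy) + norm (wx - wy) \<le> Q * (norm ?Gx + norm ?Gy) + Q * \<kappa>0 / (8 * R) * norm (x - y)"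
  proof (intro add_mono mult_left_mono norm_triangle_ineq4)
    have "8 * R ^ 2 \<le> Q * \<kappa>0" using Q8 \<kappa>0 by (simp add: field_simps)
    then have "R \<le> Q * \<kappa>0 / (8 * R)" using R by (simp add: field_simps power2_eq_square)
    then show "norm (wx - wy) \<le> Q * \<kappa>0 / (8 * R) * norm (x - y)"
      using w(2) by (meson mult_right_mono norm_ge_zero order_trans)
  qed (use Q0 in auto)
  finally have "Q * (\<kappa>0 / (8 * R) * norm (x - y)) \<le> Q * (norm ?Gx + norm ?Gy)"
    by (simp add: field_simps)
  then have "\<kappa>0 / (8 * R) * norm (x - y) \<le> norm ?Gx + norm ?Gy" using Q0 by (simp only: mult_le_cancel_left_pos)
  moreover have "\<kappa> * norm (x - y) \<le> \<kappa>0 / (8 * R) * norm (x - y)" using \<kappa>(1) by (rule mult_right_mono) simp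
  ultimately show ?thesis by linarith
next
  case False
  have QR: "Q \<ge> 4 * R"
  proof -
    have "8 * R ^ 2 / \<kappa>0 \<ge> 0" using \<kappa>0 by simp
    then show "Q \<ge> 4 * R" using Q by linarith
  qed
  then have Q0: "Q > 0" using R by linarith
  have bR: "\<bar>b\<bar> * R \<le> Q / 4"
  proof -
    have "\<bar>b\<bar> * R \<le> Q / (4 * R) * R" using False R by (intro mult_right_mono) auto
    then show ?thesis using R by simp
  qed
  have "\<bar>b\<bar> \<le> \<bar>b\<bar> * R" using mult_left_mono[OF R, of "\<bar>b\<bar>"] by simp
  then have "\<bar>b\<bar> < Q" using bR Q0 by linarith
  then obtain i where i: "\<bar>a $ i\<bar> = Q" using b(2) by blast
  have "Q \<le> norm a" using i component_le_norm_cart[of a i] by simp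
  also have "\<dots> \<le> norm (a + b *\<^sub>R ux - wx) + (norm (b *\<^sub>R ux) + norm wx)"
    using norm_triangle_ineq4[of "a + b *\<^sub>R ux - wx" "b *\<^sub>R ux - wx"] norm_triangle_ineq4[of "b *\<^sub>R ux" wx]
    by simp
  also have "norm (b *\<^sub>R ux) + norm wx \<le> Q / 4 + Q / 4"
  proof (rule add_mono)
    have "norm (b *\<^sub>R ux) \<le> \<bar>b\<bar> * R" using u(1) by (simp add: mult_left_mono)
    then show "norm (b *\<^sub>R ux) \<le> Q / 4" using bR by linarith
    show "norm wx \<le> Q / 4" using w(1) QR by linarith
  qed
  finally have "Q / 2 \<le> norm (a + b *\<^sub>R ux - wx)" by simp
  moreover have "norm (a + b *\<^sub>R ux - wx) = Q * norm ?Gx" using Q0 by simp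
  ultimately have "Q * (1 / 2) \<le> Q * norm ?Gx" by linarith
  then have "1 / 2 \<le> norm ?Gx" using Q0 by (simp only: mult_le_cancel_left_pos)
  moreover have "\<kappa> * norm (x - y) \<le> 1 / 2"
  proof -
    have "\<kappa> * norm (x - y) \<le> 1 / (4 * \<delta>) * norm (x - y)" using \<kappa>(2) by (rule mult_right_mono) simp
    also have "\<dots> \<le> 1 / (4 * \<delta>) * (2 * \<delta>)" using xy \<delta> by (intro mult_left_mono) auto
    finally show ?thesis using \<delta> by simp
  qed
  ultimately show ?thesis using norm_ge_zero[of ?Gy] by linarith
qed

section \<open>Approximation on the graph\<close>

text \<open>For each \<open>q\<close> only finitely many \<open>p\<close> lie within
  \<open>b q\<close> of \<open>a q\<close>. Hence \<open>p\<close> may be quantified away, and the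
  limsup is taken over \<open>q\<close> alone.\<close>

lemma infinite_solutions_imp_infinite_q:
  fixes a b :: "'q \<Rightarrow> real"
  assumes "infinite {(p::int, q). \<bar>a q - real_of_int p\<bar> < b q}"
  shows "infinite {q. \<exists>p::int. \<bar>a q - real_of_int p\<bar> < b q}"
proof
  assume fin: "finite {q. \<exists>p::int. \<bar>a q - real_of_int p\<bar> < b q}"
  have "{(p::int, q). \<bar>a q - real_of_int p\<bar> < b q} \<subseteq>
      (\<Union>q\<in>{q. \<exists>p::int. \<bar>a q - real_of_int p\<bar> < b q}. {\<lfloor>a q - b q\<rfloor>..\<lceil>a q + b q\<rceil>} \<times> {q})"
    by (auto simp: floor_le_iff le_ceiling_iff) 
  then show False using assms fin by (meson finite_UN_I finite_SigmaI finite_atLeastAtMost_int finite.intros finite_subset)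
qed

text \<open>The function \<open>h\<close> stands for \<theta> along the graph. The uniform sublevel
  bound is applied to every pair of \<open>q\<close> and \<open>p\<close> with
  \<open>\<eta> = \<Psi> q / sup_norm q\<close>; summing over \<open>p\<close> gives a constant
  times the term of the series at \<open>q\<close>.\<close>

lemma hausdorff_null_near_nonsingular:
  fixes g h :: "real^'m \<Rightarrow> real" and f :: "real \<Rightarrow> real"
  defines "M \<equiv> real CARD('m)"
  assumes U: "open U" and g: "C2_on U g" and h: "C2_on U h" and x0: "x0 \<in> U" "invertible (hessian g x0)"
    and \<Psi>: "approximating_function \<Psi>" and f: "dimension_function f"
    and s: "s < 2 * (M - 1)" and c: "c > 0"
    and growth: "\<And>x y. 0 < y \<Longrightarrow> y < 1 \<Longrightarrow> 1 < x \<Longrightarrow> f (x * y) \<le> c * x powr s * f y"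
    and sum: "(\<lambda>q. if \<Psi> q = 0 then 0
        else sup_norm q ^ CARD('m) * (1 / \<Psi> q) ^ (CARD('m) - 1) * f (\<Psi> q / sup_norm q)) summable_on (- {0})"
  obtains \<delta> where "\<delta> > 0"
    "hausdorff_measure f {x \<in> cball x0 \<delta>.
      infinite {(p::int, q). \<bar>int_dot q (x, g x) - real_of_int p - h x\<bar> < \<Psi> q}} = 0"
proof -
  have f0: "f 0 = 0" and fmono: "\<And>x y. 0 \<le> x \<Longrightarrow> x \<le> y \<Longrightarrow> f x \<le> f y"
    using f by (auto simp: dimension_function_def mono_on_def)
  have \<Psi>0: "\<Psi> q \<ge> 0" for q using \<Psi> unfolding approximating_function_def by blast
  obtain \<delta> \<kappa>0 where \<delta>: "\<delta> > 0" "cball x0 \<delta> \<subseteq> U" and \<kappa>0: "\<kappa>0 > 0"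
    "\<And>x y. x \<in> cball x0 \<delta> \<Longrightarrow> y \<in> cball x0 \<delta> \<Longrightarrow> \<kappa>0 * norm (x - y) \<le> norm (gradient g x - gradient g y)"
    using gradient_bilipschitz_near_nonsingular[OF g U x0] by metis
  let ?B = "cball x0 \<delta>"
  obtain R1 where R1: "R1 > 0"
    "\<And>x. x \<in> ?B \<Longrightarrow> \<bar>g x\<bar> \<le> R1" "\<And>x. x \<in> ?B \<Longrightarrow> norm (gradient g x) \<le> R1"
    "\<And>x y. x \<in> ?B \<Longrightarrow> y \<in> ?B \<Longrightarrow> norm (gradient g x - gradient g y) \<le> R1 * norm (x - y)"
    using C2_on_local_bounds[OF g U \<delta>(2)] by metis
  obtain R2 where R2: "R2 > 0"
    "\<And>x. x \<in> ?B \<Longrightarrow> \<bar>h x\<bar> \<le> R2" "\<And>x. x \<in> ?B \<Longrightarrow> norm (gradient h x) \<le> R2"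
    "\<And>x y. x \<in> ?B \<Longrightarrow> y \<in> ?B \<Longrightarrow> norm (gradient h x - gradient h y) \<le> R2 * norm (x - y)"
    using C2_on_local_bounds[OF h U \<delta>(2)] by metis
  define R where "R = 1 + R1 + R2"
  have R: "R \<ge> 1" "R1 \<le> R" "R2 \<le> R" using R1(1) R2(1) by (auto simp: R_def)
  have gb: "\<bar>g x\<bar> \<le> R" "norm (gradient g x) \<le> R" "\<bar>h x\<bar> \<le> R" "norm (gradient h x) \<le> R" if "x \<in> ?B" for x
    using R1(2,3)[OF that] R2(2,3)[OF that] R by linarith+
  have lip: "norm (gradient g x - gradient g y) \<le> R * norm (x - y)"
    "norm (gradient h x - gradient h y) \<le> R * norm (x - y)" if "x \<in> ?B" "y \<in> ?B" for x y
    using R1(4)[OF that] R2(4)[OF that] R by (meson mult_right_mono norm_ge_zero order_trans)+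
  define \<kappa> where "\<kappa> = min (\<kappa>0 / (8 * R)) (1 / (4 * \<delta>))"
  have \<kappa>: "\<kappa> > 0" "\<kappa> \<le> \<kappa>0 / (8 * R)" "\<kappa> \<le> 1 / (4 * \<delta>)" using \<kappa>0(1) R \<delta> by (auto simp: \<kappa>_def)
  have diam: "dist x y \<le> 2 * \<delta>" if "x \<in> ?B" "y \<in> ?B" for x y
    using that dist_triangle2[of x y x0] by (simp add: dist_commute)
  have R0: "2 * R \<ge> 0" and d0: "2 * \<delta> \<ge> 0" using R \<delta> by auto
  obtain C where C: "C > 0"
    "\<And>(B :: (real^'m) set) F G \<eta> \<rho>. separated_gradient_on B (2 * R) \<kappa> (2 * \<delta>) F G \<Longrightarrow>
      0 < \<eta> \<Longrightarrow> \<eta> < 1 \<Longrightarrow> C * sqrt \<eta> \<le> \<rho> \<Longrightarrow>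
      hausdorff_premeasure f \<rho> {x \<in> B. \<bar>F x\<bar> < \<eta>} \<le> ennreal (C * ((1 / \<eta>) ^ (CARD('m) - 1) * f \<eta>))"
    by (rule hausdorff_premeasure_sublevel[OF f s[unfolded M_def] c growth R0 \<kappa>(1) d0])
      (assumption+, rule that, assumption, blast)
  \<comment> \<open>Every relevant \<open>p\<close> satisfies
    \<open>\<bar>p\<bar> \<le> P * Q\<close>: the first summand comes from the linear part, one
    \<open>R\<close> each from \<open>g\<close> and \<open>h\<close>, and the 1 from
    \<open>\<Psi> q < 1\<close>.\<close>
  define P where "P = M * (norm x0 + \<delta>) + 2 * R + 1"
  have P: "P > 0" using \<delta> R by (simp add: P_def M_def add_nonneg_pos)
  define S where "S q = {x \<in> ?B. \<exists>p::int. \<bar>(int_dot q (x, g x) - h x) - real_of_int p\<bar> < \<Psi> q}" for q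
  define u where "u q = (if \<Psi> q = 0 then 0
        else sup_norm q ^ CARD('m) * (1 / \<Psi> q) ^ (CARD('m) - 1) * f (\<Psi> q / sup_norm q))" for q
  obtain N1 where N1: "\<And>q. N1 \<le> sup_norm q \<Longrightarrow> \<Psi> q < 1"
  proof -
    have "(\<Psi> \<longlongrightarrow> 0) (filtercomap sup_norm at_top)" using \<Psi> by (simp add: approximating_function_def)
    then have "\<forall>\<^sub>F q in filtercomap sup_norm at_top. \<Psi> q < 1" by (rule order_tendstoD(2)) simp
    then show thesis using that unfolding eventually_filtercomap eventually_at_top_linorder by blast
  qed
  \<comment> \<open>The three thresholds secure, in this order, the gradient separation,
    \<open>\<Psi> q < 1\<close>, and diameters at most \<open>\<rho>\<close>. If
    \<open>\<Psi> q = 0\<close>, the strict inequality has no solution, in accordance with the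
    convention for the series.\<close>
  have Sbound: "hausdorff_premeasure f \<rho> (S q) \<le> ennreal ((2 * P + 1) * C * u q)"
    if \<rho>: "\<rho> > 0" and q: "4 * R + 8 * R ^ 2 / \<kappa>0 \<le> sup_norm q" "N1 \<le> sup_norm q" "(C / \<rho>)\<^sup>2 \<le> sup_norm q" for \<rho> q
  proof (cases "\<Psi> q = 0")
    case True
    then have "S q = {}" by (simp add: S_def)
    then show ?thesis using \<rho> f0 by (simp add: hausdorff_premeasure_empty)
  next
    case False
    define Q where "Q = sup_norm q"
    define \<eta> where "\<eta> = \<Psi> q / Q"
    have "8 * R ^ 2 / \<kappa>0 \<ge> 0" using \<kappa>0 by simp
    then have Q: "Q \<ge> 4" "Q \<ge> 1" "Q > 0" using q(1) R unfolding Q_def by linarith+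
    have \<Psi>q: "0 < \<Psi> q" "\<Psi> q < 1" using False \<Psi>0[of q] N1[OF q(2)] by auto
    have \<eta>: "0 < \<eta>" "\<eta> < 1" "\<eta> \<le> 1 / Q" using \<Psi>q Q by (auto simp: \<eta>_def field_simps)
    have C\<rho>: "C * sqrt \<eta> \<le> \<rho>"
    proof -
      have "C\<^sup>2 / \<rho>\<^sup>2 \<le> Q" using q(3) by (simp add: Q_def power_divide)
      then have "1 / Q \<le> (\<rho> / C)\<^sup>2" using Q \<rho> C(1) by (simp add: field_simps)
      then have "\<eta> \<le> (\<rho> / C)\<^sup>2" using \<eta> by linarith
      then have "sqrt \<eta> \<le> \<rho> / C" using \<rho> C(1) by (intro real_le_lsqrt) auto
      then show ?thesis using C(1) by (simp add: field_simps)
    qed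
    define a where "a = real_vec q"
    define b where "b = real_of_int (snd q)"
    have b: "\<bar>b\<bar> \<le> Q" "\<bar>b\<bar> < Q \<Longrightarrow> \<exists>i. \<bar>a $ i\<bar> = Q"
      using sup_norm_bounds(1)[of q] sup_norm_attained[of q] by (auto simp: Q_def a_def b_def)
    define F where "F p x = (a \<bullet> x + b * g x - real_of_int p - h x) / Q" for p :: int and x
    define G where "G x = (1 / Q) *\<^sub>R (a + b *\<^sub>R gradient g x - gradient h x)" for x
    have der: "(F p has_derivative (\<lambda>v. G x \<bullet> v)) (at x within ?B)" if "x \<in> ?B" for p x
    proof -
      have xU: "x \<in> U" using that \<delta> by blast
      have d: "((\<lambda>x. a \<bullet> x) has_derivative (\<lambda>v. a \<bullet> v)) (at x within ?B)"
        "(g has_derivative (\<lambda>v. gradient g x \<bullet> v)) (at x within ?B)"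
        "(h has_derivative (\<lambda>v. gradient h x \<bullet> v)) (at x within ?B)"
        using C2_onD(1)[OF g U xU] C2_onD(1)[OF h U xU]
        by (auto intro: has_derivative_at_withinI bounded_linear_imp_has_derivative bounded_linear_inner_right)
      have "((\<lambda>x. (1 / Q) *\<^sub>R (a \<bullet> x + b *\<^sub>R g x - real_of_int p - h x)) has_derivative
          (\<lambda>v. (1 / Q) *\<^sub>R (a \<bullet> v + b *\<^sub>R (gradient g x \<bullet> v) - 0 - gradient h x \<bullet> v))) (at x within ?B)"
        by (intro has_derivative_scaleR_right has_derivative_diff has_derivative_add d has_derivative_const)
      then show ?thesis by (simp add: F_def[abs_def] G_def inner_diff_left inner_add_left)
    qed
    have piece: "hausdorff_premeasure f \<rho> {x \<in> ?B. \<bar>F p x\<bar> < \<eta>} \<le> ennreal (C * ((1 / \<eta>) ^ (CARD('m) - 1) * f \<eta>))" for p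
    proof (rule C(2)[OF _ \<eta>(1,2) C\<rho>], unfold separated_gradient_on_def, intro ballI conjI)
      fix x y assume xy: "x \<in> ?B" "y \<in> ?B"
      show "\<bar>F p x - F p y - G x \<bullet> (x - y)\<bar> \<le> 2 * R * norm (x - y) ^ 2"
      proof (rule quadratic_taylor_bound[OF convex_cball xy der _ R0])
        fix y z assume "y \<in> ?B" "z \<in> ?B"
        then show "norm (G y - G z) \<le> 2 * R * norm (y - z)"
          unfolding G_def using Q(2) b(1) R lip by (intro normalized_gradient_lipschitz) auto
      qed
      show "\<kappa> * dist x y \<le> norm (G x) + norm (G y)"
        unfolding G_def dist_norm
        by (rule normalized_gradient_separation[OF R(1) \<kappa>0(1) \<delta>(1) q(1)[folded Q_def] b gb(2)[OF xy(1)]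
              \<kappa>0(2)[OF xy] gb(4)[OF xy(1)] lip(2)[OF xy] diam[OF xy, unfolded dist_norm] \<kappa>(2,3)])
      show "dist x y \<le> 2 * \<delta>" by (rule diam[OF xy])
    qed
    define I where "I = {- \<lfloor>P * Q\<rfloor>..\<lfloor>P * Q\<rfloor>}"
    have cover: "S q \<subseteq> (\<Union>p\<in>I. {x \<in> ?B. \<bar>F p x\<bar> < \<eta>})"
    proof
      fix x assume "x \<in> S q"
      then obtain p :: int where x: "x \<in> ?B" and p: "\<bar>(int_dot q (x, g x) - h x) - real_of_int p\<bar> < \<Psi> q"
        by (auto simp: S_def)
      have p': "\<bar>a \<bullet> x + b * g x - real_of_int p - h x\<bar> < \<Psi> q"
        using p by (simp add: int_dot_eq a_def b_def algebra_simps)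
      then have "\<bar>F p x\<bar> < \<eta>" using Q by (simp add: F_def \<eta>_def divide_strict_right_mono)
      moreover have "p \<in> I"
      proof -
        have "\<bar>a \<bullet> x\<bar> \<le> M * Q * (norm x0 + \<delta>)"
        proof -
          have "norm x \<le> norm x0 + \<delta>"
            using x norm_triangle_ineq[of x0 "x - x0"] by (simp add: dist_norm norm_minus_commute)
          then have "norm a * norm x \<le> M * Q * (norm x0 + \<delta>)"
            using norm_real_vec_le[of q] Q by (intro mult_mono) (auto simp: a_def Q_def M_def)
          then show ?thesis using Cauchy_Schwarz_ineq2[of a x] by linarith
        qed
        moreover have "\<bar>b * g x\<bar> \<le> Q * R"
          unfolding abs_mult using b(1) gb(1)[OF x] Q by (intro mult_mono) auto
        moreover have "\<bar>h x\<bar> \<le> Q * R"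
        proof -
          have "1 * R \<le> Q * R" using Q R by (intro mult_right_mono) auto
          then show ?thesis using gb(3)[OF x] by linarith
        qed
        ultimately have "\<bar>real_of_int p\<bar> \<le> M * Q * (norm x0 + \<delta>) + Q * R + Q * R + Q"
          using p' \<Psi>q(2) Q(2) by linarith
        also have "\<dots> = P * Q" by (simp add: P_def algebra_simps)
        finally have "\<bar>real_of_int p\<bar> \<le> P * Q" .
        then show ?thesis unfolding I_def by (auto simp: le_floor_iff) linarith+
      qed
      ultimately show "x \<in> (\<Union>p\<in>I. {x \<in> ?B. \<bar>F p x\<bar> < \<eta>})" using x by blast
    qed
    have cardI: "real (card I) \<le> (2 * P + 1) * Q"
    proof -
      have "\<lfloor>P * Q\<rfloor> \<ge> 0" using P Q by simp
      then have "real (card I) = 2 * real_of_int \<lfloor>P * Q\<rfloor> + 1" by (simp add: I_def)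
      also have "\<dots> \<le> 2 * (P * Q) + Q" using Q by linarith
      finally show ?thesis by (simp add: algebra_simps)
    qed
    have f\<eta>: "f \<eta> \<ge> 0" using fmono[of 0 \<eta>] f0 \<eta> by simp
    have "hausdorff_premeasure f \<rho> (S q) \<le> hausdorff_premeasure f \<rho> (\<Union>p\<in>I. {x \<in> ?B. \<bar>F p x\<bar> < \<eta>})"
      by (rule hausdorff_premeasure_mono[OF cover])
    also have "\<dots> \<le> (\<Sum>p\<in>I. hausdorff_premeasure f \<rho> {x \<in> ?B. \<bar>F p x\<bar> < \<eta>})"
      using \<rho> f0 by (intro hausdorff_premeasure_UN_finite) (auto simp: I_def)
    also have "\<dots> \<le> (\<Sum>p\<in>I. ennreal (C * ((1 / \<eta>) ^ (CARD('m) - 1) * f \<eta>)))"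
      by (intro sum_mono piece)
    also have "\<dots> = ennreal (real (card I) * (C * ((1 / \<eta>) ^ (CARD('m) - 1) * f \<eta>)))"
      by (simp only: sum_constant ennreal_of_nat_eq_real_of_nat ennreal_mult'[OF of_nat_0_le_iff])
    also have "\<dots> \<le> ennreal ((2 * P + 1) * Q * (C * ((1 / \<eta>) ^ (CARD('m) - 1) * f \<eta>)))"
      using cardI C(1) f\<eta> \<eta> by (intro ennreal_leI mult_right_mono) auto
    \<comment> \<open>The count of \<open>p\<close> contributes one factor \<open>Q\<close> and the
      power of \<open>1 / \<eta>\<close> the other \<open>CARD('m) - 1\<close>.\<close>
    also have "(2 * P + 1) * Q * (C * ((1 / \<eta>) ^ (CARD('m) - 1) * f \<eta>)) = (2 * P + 1) * C * u q"
    proof -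
      have "(1 / \<eta>) ^ (CARD('m) - 1) = Q ^ (CARD('m) - 1) * (1 / \<Psi> q) ^ (CARD('m) - 1)"
        by (simp add: \<eta>_def power_divide)
      moreover have "Q * Q ^ (CARD('m) - 1) = Q ^ CARD('m)" by (cases "CARD('m)") auto
      ultimately have "Q * ((1 / \<eta>) ^ (CARD('m) - 1) * f \<eta>) = Q ^ CARD('m) * (1 / \<Psi> q) ^ (CARD('m) - 1) * f \<eta>"
        by (simp only: mult.assoc[symmetric])
      also have "\<dots> = u q" using False by (simp add: u_def \<eta>_def Q_def)
      finally have "Q * ((1 / \<eta>) ^ (CARD('m) - 1) * f \<eta>) = u q" .
      moreover have "(2 * P + 1) * Q * (C * ((1 / \<eta>) ^ (CARD('m) - 1) * f \<eta>))
          = (2 * P + 1) * C * (Q * ((1 / \<eta>) ^ (CARD('m) - 1) * f \<eta>))"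
        by (simp only: mult_ac)
      ultimately show ?thesis by simp
    qed
    finally show ?thesis .
  qed
  have "hausdorff_measure f {x. infinite {q. x \<in> S q}} = 0"
  proof (rule hausdorff_null_limsup[where Y = "{0}" and u = u and K = "(2 * P + 1) * C"])
    show "0 \<le> u q" for q
      using fmono[of 0 "\<Psi> q / sup_norm q"] f0 \<Psi>0[of q] sup_norm_nonneg[of q] by (simp add: u_def)
    show "u summable_on - {0}" using sum by (simp add: u_def[abs_def])
    show "\<exists>X. finite X \<and> (\<forall>q. q \<notin> X \<longrightarrow> hausdorff_premeasure f \<rho> (S q) \<le> ennreal ((2 * P + 1) * C * u q))"
      if "\<rho> > 0" for \<rho>
    proof -
      define N where "N = max (4 * R + 8 * R ^ 2 / \<kappa>0) (max N1 ((C / \<rho>)\<^sup>2))"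
      show ?thesis
        using finite_sup_norm_le[of N] Sbound[OF that]
        by (intro exI[of _ "{q. sup_norm q \<le> N}"]) (auto simp: N_def)
    qed
  qed (use f0 P C in auto)
  moreover have "{x \<in> ?B. infinite {(p::int, q). \<bar>int_dot q (x, g x) - real_of_int p - h x\<bar> < \<Psi> q}}
      \<subseteq> {x. infinite {q. x \<in> S q}}"
  proof
    fix x assume x: "x \<in> {x \<in> ?B. infinite {(p::int, q). \<bar>int_dot q (x, g x) - real_of_int p - h x\<bar> < \<Psi> q}}"
    then have "infinite {(p::int, q). \<bar>(int_dot q (x, g x) - h x) - real_of_int p\<bar> < \<Psi> q}"
      by (simp add: algebra_simps)
    then have "infinite {q. \<exists>p::int. \<bar>(int_dot q (x, g x) - h x) - real_of_int p\<bar> < \<Psi> q}"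
      by (rule infinite_solutions_imp_infinite_q)
    then show "x \<in> {x. infinite {q. x \<in> S q}}" using x by (simp add: S_def)
  qed
  ultimately show thesis using that[OF \<delta>(1)] hausdorff_null_subset by blast
qed

text \<open>The gradient may be unbounded on \<open>U\<close>, so the estimate is made on small
  balls. The constant exceeds 1 so that it can serve as the scaling factor in the growth
  condition.\<close>

lemma graph_map_locally_lipschitz:
  fixes g :: "real^'m \<Rightarrow> real"
  assumes U: "open U" and g: "C2_on U g" and "x0 \<in> U"
  obtains r K where "r > 0" "K > 1" "K-lipschitz_on (ball x0 r) (\<lambda>x. (x, g x))"
proof -
  obtain r where r: "r > 0" "cball x0 r \<subseteq> U" using assms open_contains_cball by blast
  obtain R where R: "R > 0" "\<And>x. x \<in> cball x0 r \<Longrightarrow> norm (gradient g x) \<le> R"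
    using C2_on_local_bounds[OF g U r(2)] by metis
  have lip: "norm (g x - g y) \<le> R * norm (x - y)" if "x \<in> ball x0 r" "y \<in> ball x0 r" for x y
  proof (rule differentiable_bound[of "ball x0 r"])
    fix z assume z: "z \<in> ball x0 r"
    then have "z \<in> cball x0 r" by simp
    then show "(g has_derivative (\<lambda>h. gradient g z \<bullet> h)) (at z within ball x0 r)"
      using C2_onD(1)[OF g U] r(2) by (meson has_derivative_at_withinI subsetD)
    show "onorm (\<lambda>h. gradient g z \<bullet> h) \<le> R"
    proof (rule onorm_bound)
      fix h
      have "norm (gradient g z \<bullet> h) \<le> norm (gradient g z) * norm h"
        by (simp add: Cauchy_Schwarz_ineq2)
      also have "\<dots> \<le> R * norm h" using R(2)[OF \<open>z \<in> cball x0 r\<close>] by (rule mult_right_mono) simp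
      finally show "norm (gradient g z \<bullet> h) \<le> R * norm h" .
    qed (use R in simp)
  qed (use that in auto)
  show thesis
  proof (rule that[OF r(1), of "1 + R"])
    show "(1 + R)-lipschitz_on (ball x0 r) (\<lambda>x. (x, g x))"
    proof (rule lipschitz_onI)
      fix x y assume "x \<in> ball x0 r" "y \<in> ball x0 r"
      then have "dist (g x) (g y) \<le> R * dist x y" using lip by (simp add: dist_norm)
      moreover have "dist (x, g x) (y, g y) \<le> dist x y + dist (g x) (g y)"
        by (simp add: dist_Pair_Pair sqrt_sum_squares_le_sum)
      ultimately show "dist (x, g x) (y, g y) \<le> (1 + R) * dist x y" by (simp add: algebra_simps)
    qed (use R in simp)
  qed (use R in simp)
qed

theorem theorem1p3:
  fixes n :: nat
    and U :: "(real^'m) set"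
    and g :: "real^'m \<Rightarrow> real"
    and \<theta> :: "(real^'m) \<times> real \<Rightarrow> real"
    and \<Psi> :: "(int^'m) \<times> int \<Rightarrow> real"
    and f :: "real \<Rightarrow> real"
  assumes "n \<ge> 2" and "CARD('m) = n - 1"
    and "open U" and "connected U" and "bounded U"
    and "C2_on U g"
    and "C2_on U (\<lambda>x. \<theta> (x, g x))"
    and "approximating_function \<Psi>"
    and "dimension_function f"
    and "\<exists>s c. s < 2 * (real n - 2) \<and> c > 0 \<and>
           (\<forall>x y. 0 < y \<and> y < 1 \<and> 1 < x \<longrightarrow> f (x * y) \<le> c * x powr s * f y)"
    and "hausdorff_measure f {x \<in> U. \<not> invertible (hessian g x)} = 0"
    and "(\<lambda>q. if \<Psi> q = 0 then 0
              else sup_norm q ^ (n - 1) * \<Psi> q powi (2 - int n) * f (\<Psi> q / sup_norm q))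
           summable_on (UNIV - {0})"
  shows "hausdorff_measure f (W_on (graph_over U g) \<theta> \<Psi>) = 0"
proof -
  have f0: "f 0 = 0" using assms(9) by (simp add: dimension_function_def)
  obtain s c where s: "s < 2 * (real CARD('m) - 1)" and c: "c > 0"
    and growth: "\<And>x y. 0 < y \<Longrightarrow> y < 1 \<Longrightarrow> 1 < x \<Longrightarrow> f (x * y) \<le> c * x powr s * f y"
  proof -
    have "2 * (real n - 2) = 2 * (real CARD('m) - 1)" using assms(1,2) by (simp add: of_nat_diff)
    then show thesis using that assms(10) by metis
  qed
  \<comment> \<open>With \<open>CARD('m) = n - 1\<close> the exponent \<open>2 - n\<close> becomes
    \<open>-(CARD('m) - 1)\<close>, a natural power of \<open>1 / \<Psi> q\<close>.\<close>
  have sum: "(\<lambda>q. if \<Psi> q = 0 then 0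
      else sup_norm q ^ CARD('m) * (1 / \<Psi> q) ^ (CARD('m) - 1) * f (\<Psi> q / sup_norm q)) summable_on (- {0})"
  proof -
    have "2 - int n = - int (CARD('m) - 1)" using assms(1,2) by simp
    then have powi: "\<Psi> q powi (2 - int n) = (1 / \<Psi> q) ^ (CARD('m) - 1)" for q
      by (simp only: power_int_minus power_int_of_nat power_one_over inverse_eq_divide)
    show ?thesis
      using assms(12) unfolding powi assms(2)[symmetric] Compl_eq_Diff_UNIV .
  qed
  define \<phi> where "\<phi> x = (x, g x)" for x
  define A where "A = {x \<in> U. infinite {(p::int, q). \<bar>int_dot q (x, g x) - real_of_int p - \<theta> (x, g x)\<bar> < \<Psi> q}}"
  define Z where "Z = {x \<in> U. \<not> invertible (hessian g x)}"
  \<comment> \<open>Carries nullity from the parameter domain to the graph near a point; the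
    doubling constant \<open>c * K powr s\<close> is the growth condition at the factor
    \<open>K\<close>.\<close>
  have image_null: "\<exists>V. open V \<and> x \<in> V \<and> hausdorff_measure f (\<phi> ` (T \<inter> V)) = 0"
    if "x \<in> U" "r > 0" "hausdorff_measure f (T \<inter> ball x r) = 0" for x r T
  proof -
    obtain r' K where K: "r' > 0" "K > 1" "K-lipschitz_on (ball x r') \<phi>"
      using graph_map_locally_lipschitz[OF assms(3,6) \<open>x \<in> U\<close>] unfolding \<phi>_def by blast
    let ?V = "ball x (min r r')"
    have "hausdorff_measure f (T \<inter> ?V) = 0"
      by (rule hausdorff_null_subset[OF _ that(3)]) auto
    then have "hausdorff_measure f (\<phi> ` (T \<inter> ?V)) = 0"
    proof (rule hausdorff_null_lipschitz_image[OF assms(9), rotated -1])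
      show "f (K * y) \<le> (c * K powr s) * f y" if "0 < y" "y < 1" for y using growth[OF that K(2)] .
      show "K-lipschitz_on (T \<inter> ?V) \<phi>" by (rule lipschitz_on_subset[OF K(3)]) auto
    qed
    then show ?thesis using K(1) that(2) by (intro exI[of _ ?V]) auto
  qed
  have "hausdorff_measure f (\<phi> ` Z) = 0"
  proof (rule hausdorff_null_image_locally)
    fix x assume "x \<in> Z"
    then have "x \<in> U" by (simp add: Z_def)
    moreover have "hausdorff_measure f (Z \<inter> ball x 1) = 0"
      by (rule hausdorff_null_subset[OF Int_lower1]) (simp add: Z_def assms(11))
    ultimately show "\<exists>V. open V \<and> x \<in> V \<and> hausdorff_measure f (\<phi> ` (Z \<inter> V)) = 0"
      using image_null[of x 1 Z] by simp
  qed (rule f0)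
  moreover have "hausdorff_measure f (\<phi> ` (A - Z)) = 0"
  proof (rule hausdorff_null_image_locally)
    fix x assume "x \<in> A - Z"
    then have x: "x \<in> U" "invertible (hessian g x)" by (auto simp: A_def Z_def)
    obtain \<delta> where \<delta>: "\<delta> > 0" "hausdorff_measure f {y \<in> cball x \<delta>.
        infinite {(p::int, q). \<bar>int_dot q (y, g y) - real_of_int p - \<theta> (y, g y)\<bar> < \<Psi> q}} = 0"
      by (rule hausdorff_null_near_nonsingular[OF assms(3,6,7) x assms(8,9) s c growth sum])
        (assumption | (rule that; assumption))+
    have "hausdorff_measure f ((A - Z) \<inter> ball x \<delta>) = 0"
      by (rule hausdorff_null_subset[OF _ \<delta>(2)]) (auto simp: A_def)
    then show "\<exists>V. open V \<and> x \<in> V \<and> hausdorff_measure f (\<phi> ` ((A - Z) \<inter> V)) = 0"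
      using image_null[OF x(1) \<delta>(1)] by simp
  qed (rule f0)
  \<comment> \<open>The union over the two truth values makes the lemma on countable unions
    applicable to the singular and the nonsingular part.\<close>
  ultimately have "hausdorff_measure f (\<Union>b\<in>UNIV. if b then \<phi> ` Z else \<phi> ` (A - Z)) = 0"
    by (intro hausdorff_null_UN f0) (auto simp: countable_finite)
  moreover have "W_on (graph_over U g) \<theta> \<Psi> \<subseteq> (\<Union>b\<in>UNIV. if b then \<phi> ` Z else \<phi> ` (A - Z))"
  proof
    fix y assume "y \<in> W_on (graph_over U g) \<theta> \<Psi>"
    then obtain x where "x \<in> A" "y = \<phi> x" by (auto simp: W_on_def graph_over_def A_def \<phi>_def)
    then have "y \<in> \<phi> ` Z \<or> y \<in> \<phi> ` (A - Z)" by blast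
    then show "y \<in> (\<Union>b\<in>UNIV. if b then \<phi> ` Z else \<phi> ` (A - Z))" by (auto simp: UNIV_bool)
  qed
  ultimately show ?thesis using hausdorff_null_subset by blast
qed

end
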